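(* Let $a\in\{2,3,\dots\}$ and $\rho=1/(2a)$. The process $(\Xi(t),t\in\mathbb{N}_0,\mathbb{P}_{\delta_{2a\mathbb{Z}}})$, i.e. the noncolliding random walk started at $\delta_{2a\mathbb{Z}}=\sum_{k\in\mathbb{Z}}\delta_{2ak}$, shows a relaxation phenomenon to an equilibrium state: as $n\to\infty$, $$\Xi(2n)\Rightarrow\mu^{\sin}_{\rho,\mathrm{e}},\qquad \Xi(2n+1)\Rightarrow\mu^{\sin}_{\rho,\mathrm{o}}$$ (weak convergence in law). The equilibrium process $(\Xi(t),t\in\mathbb{Z},\mathbf{P}_\rho)$, i.e. the limit as $n\to\infty$, in the sense of finite dimensional distributions, of the time-shifted processes $\Xi(2n+t)$, $t\in\mathbb{Z}$, under $\mathbb{P}_{\delta_{2a\mathbb{Z}}}$, is time-reversible and is determinantal with the correlation kernel given, for $(s,x),(t,y)\in\mathbb{Z}^2$ with $s+x$ and $t+y$ even, by $$\mathbf{K}_\rho(t-s,y-x)=\begin{cases}\displaystyle\int_0^\rho du\,\frac{2\cos(\pi u(y-x))}{[\cos(\pi u)]^{t-s}},& s<t,\\[2mm]\displaystyle\frac{2\sin(\pi\rho(y-x))}{\pi(y-x)},& s=t,\\[2mm]\displaystyle-\int_\rho^{1/2}du\,\frac{2\cos(\pi u(y-x))}{[\cos(\pi u)]^{t-s}},& s>t,\end{cases}$$ and $\mathbf{K}_\rho(t-s,y-x)=0$ otherwise.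
   Context: $\mathbb{N}=\{1,2,\dots\}$, $\mathbb{N}_0=\{0\}\cup\mathbb{N}$, $\mathbb{Z}_{\rm e}=2\mathbb{Z}$, $\mathbb{Z}_{\rm o}=1+2\mathbb{Z}$. Point configurations are locally finite counting measures on $\mathbb{Z}$ with at most one point at each site, with the vague topology. A process of configurations $\Xi(t)$ is determinantal with correlation kernel $\mathbf{K}(s,x;t,y)$ if for all times $t_1<\cdots<t_M$ and all finite sets of distinct points $x^{(m)}_1<\cdots<x^{(m)}_{N_m}$ in $\mathbb{Z}$, $1\le m\le M$, the correlation function (the probability that $\Xi(t_m)$ has a particle at each $x^{(m)}_j$, $1\le j\le N_m$, $1\le m\le M$) equals $\det_{1\le j\le N_m,1\le k\le N_n,1\le m,n\le M}[\mathbf{K}(t_m,x^{(m)}_j;t_n,x^{(n)}_k)]$. A determinantal point process with kernel $\mathbf K(x,y)$ is the one-time version. For the equilibrium process, the kernel is $\mathbf{K}(s,x;t,y)=\mathbf{K}_\rho(t-s,y-x)$. Values of $\frac{2\sin(\pi\rho(y-x))}{\pi(y-x)}$ at $y=x$ are understood as the limit $2\rho$. Time-reversible means that $(\Xi(-t))_{t\in\mathbb{Z}}$ and $(\Xi(t))_{t\in\mathbb{Z}}$ have the same finite dimensional distributions. For $0<\rho<1/2$ and $\sharp\in\{\mathrm{e},\mathrm{o}\}$, $\mu^{\sin}_{\rho,\sharp}$ is the determinantal point process on $\mathbb{Z}$ with kernel $\frac{2\sin(\pi\rho(y-x))}{\pi(y-x)}$ if $x,y\in\mathbb{Z}_\sharp$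 and $0$ otherwise. The process $(\Xi(t),t\in\mathbb{N}_0,\mathbb{P}_{\delta_{2a\mathbb{Z}}})$ is the determinantal process with $\Xi(0)=\delta_{2a\mathbb{Z}}$ and correlation kernel $$\mathbb{K}_{\delta_{2a\mathbb{Z}}}(s,x;t,y)=\sum_{j\in\mathbb{Z}}p(s,x|2aj)\,\mathcal{M}^{2aj}_{\delta_{2a\mathbb{Z}}}(t,y)-\mathbf{1}(s>t)\,p(s-t,x|y)$$ for $(s,x),(t,y)\in\mathbb{N}_0\times\mathbb{Z}$ with $s+x$, $t+y$ even, and $0$ otherwise. Here $p(t,y|x)=2^{-t}\binom{t}{[t+(y-x)]/2}$ if $t\in\mathbb{N}_0$, $|y-x|\le t$ and $t+(y-x)$ is even, and $0$ otherwise (transition probability of the simple symmetric random walk), and $$\mathcal{M}^{2ak}_{\delta_{2a\mathbb{Z}}}(t,y)=\frac{1}{2\pi}\int_{-\pi}^{\pi}d\lambda\,\frac{e^{i\lambda(y/2a-k)}}{[\cos(\lambda/2a)]^t},\qquad k\in\mathbb{Z}.$$ *)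

theory Defs
  imports "HOL-Probability.Probability" "Jordan_Normal_Form.Determinant"
begin

text \<open>
  A locally finite counting measure on the integers with at most one point per site is encoded by
  its support \<open>\<xi> :: int set\<close>, that is \<open>\<xi>\<close> stands for the sum of the Dirac masses
  \<open>\<delta>\<^sub>x\<close>, \<open>x \<in> \<xi>\<close>. Every subset of the integers is locally finite.
\<close>

text \<open>
  The vague topology is the coarsest one that makes \<open>\<xi> \<mapsto> \<integral> \<phi> d\<xi>\<close> continuous for all
  compactly supported continuous \<open>\<phi>\<close>; on the discrete space of integers these are the
  finitely supported \<open>\<phi>\<close>.
\<close>

definition vague_topology :: "int set topology" where
  "vague_topology = topology_generated_by
     {{\<xi>. (\<Sum>x | x \<in> \<xi> \<and> \<phi> x \<noteq> 0. \<phi> x) \<in> U} | (\<phi> :: int \<Rightarrow> real) U.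
        finite {x. \<phi> x \<noteq> 0} \<and> open U}"

definition config_borel :: "int set measure" where
  "config_borel = sigma UNIV {U. openin vague_topology U}"

definition weakly_converges ::
    "'b topology \<Rightarrow> (nat \<Rightarrow> 'b measure) \<Rightarrow> 'b measure \<Rightarrow> bool" where
  "weakly_converges X \<mu> \<nu> \<longleftrightarrow>
     (\<forall>f. continuous_map X euclideanreal f \<and> bounded (f ` topspace X) \<longrightarrow>
        (\<lambda>n. \<integral>\<xi>. f \<xi> \<partial>\<mu> n) \<longlonglongrightarrow> (\<integral>\<xi>. f \<xi> \<partial>\<nu>))"

text \<open>
  The time set is the whole type \<open>'t\<close>. A distinct list of space-time points, sorted
  by time, is exactly a choice of times \<open>t\<^sub>1 < \<dots> < t\<^sub>M\<close> together with finitely many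
  distinct sites for each of them, in the block order of the determinant.
\<close>

definition determinantal_process ::
    "'w measure \<Rightarrow> ('t::linorder \<Rightarrow> 'w \<Rightarrow> int set)
       \<Rightarrow> ('t \<Rightarrow> int \<Rightarrow> 't \<Rightarrow> int \<Rightarrow> complex) \<Rightarrow> bool" where
  "determinantal_process M \<Xi> K \<longleftrightarrow>
     prob_space M \<and> (\<forall>t. \<Xi> t \<in> measurable M config_borel) \<and>
     (\<forall>zs :: ('t \<times> int) list. sorted (map fst zs) \<and> distinct zs \<longrightarrow>
        complex_of_real (measure M {\<omega> \<in> space M. \<forall>(t, x) \<in> set zs. x \<in> \<Xi> t \<omega>}) =
        Determinant.det (mat (length zs) (length zs)
          (\<lambda>(i, j). K (fst (zs ! i)) (snd (zs ! i)) (fst (zs ! j)) (snd (zs ! j)))))"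

definition determinantal_law :: "int set measure \<Rightarrow> (int \<Rightarrow> int \<Rightarrow> complex) \<Rightarrow> bool" where
  "determinantal_law \<mu> K \<longleftrightarrow>
     prob_space \<mu> \<and> sets \<mu> = sets config_borel \<and>
     (\<forall>xs. distinct xs \<longrightarrow>
        complex_of_real (measure \<mu> {\<xi> \<in> space \<mu>. set xs \<subseteq> \<xi>}) =
        Determinant.det (mat (length xs) (length xs) (\<lambda>(i, j). K (xs ! i) (xs ! j))))"

definition sine_fun :: "real \<Rightarrow> int \<Rightarrow> real" where
  "sine_fun \<rho> z =
     (if z = 0 then 2 * \<rho> else 2 * sin (pi * \<rho> * of_int z) / (pi * of_int z))"

definition sine_kernel :: "real \<Rightarrow> int set \<Rightarrow> int \<Rightarrow> int \<Rightarrow> complex" where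
  "sine_kernel \<rho> S x y = (if x \<in> S \<and> y \<in> S then complex_of_real (sine_fun \<rho> (y - x)) else 0)"

definition mu_sin :: "real \<Rightarrow> int set \<Rightarrow> int set measure" where
  "mu_sin \<rho> S = (THE \<mu>. determinantal_law \<mu> (sine_kernel \<rho> S))"

text \<open>\<open>srw_p t y x\<close> is the transition probability \<open>p(t, y | x)\<close> from \<open>x\<close> to \<open>y\<close>.\<close>

definition srw_p :: "nat \<Rightarrow> int \<Rightarrow> int \<Rightarrow> real" where
  "srw_p t y x =
     (if \<bar>y - x\<bar> \<le> int t \<and> even (int t + (y - x))
      then real (t choose nat ((int t + (y - x)) div 2)) / 2 ^ t else 0)"

text \<open>\<open>mart a k t y\<close> is the function with superscript \<open>2ak\<close>, evaluated at \<open>(t, y)\<close>.\<close>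

definition mart :: "nat \<Rightarrow> int \<Rightarrow> nat \<Rightarrow> int \<Rightarrow> complex" where
  "mart a k t y = 1 / (2 * complex_of_real pi) *
     integral {-pi..pi} (\<lambda>l :: real.
       exp (\<i> * complex_of_real (l * (of_int y / (2 * real a) - of_int k))) /
       complex_of_real (cos (l / (2 * real a)) ^ t))"

definition ncrw_kernel :: "nat \<Rightarrow> nat \<Rightarrow> int \<Rightarrow> nat \<Rightarrow> int \<Rightarrow> complex" where
  "ncrw_kernel a s x t y =
     (if even (int s + x) \<and> even (int t + y) then
        (\<Sum>\<^sub>\<infinity>j\<in>UNIV. complex_of_real (srw_p s x (2 * int a * j)) * mart a j t y)
          - (if s > t then complex_of_real (srw_p (s - t) x y) else 0)
      else 0)"

text \<open>The process started from one particle at each multiple of \<open>2a\<close>.\<close>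

definition ncrw_process :: "nat \<Rightarrow> 'w measure \<Rightarrow> (nat \<Rightarrow> 'w \<Rightarrow> int set) \<Rightarrow> bool" where
  "ncrw_process a M \<Xi> \<longleftrightarrow>
     determinantal_process M \<Xi> (ncrw_kernel a) \<and>
     (AE \<omega> in M. \<Xi> 0 \<omega> = range (\<lambda>k :: int. 2 * int a * k))"

text \<open>
  In the case \<open>\<tau> < 0\<close> the integrand is \<open>2 cos(\<pi>uz) cos(\<pi>u)\<^sup>-\<^sup>\<tau>\<close>; it vanishes at \<open>u = 1/2\<close>
  also under the convention that \<open>0 powi \<tau> = 0\<close> and \<open>x / 0 = 0\<close>.
\<close>

definition eq_fun :: "real \<Rightarrow> int \<Rightarrow> int \<Rightarrow> real" where
  "eq_fun \<rho> \<tau> z =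
     (if \<tau> > 0 then integral {0..\<rho>} (\<lambda>u. 2 * cos (pi * u * of_int z) / cos (pi * u) powi \<tau>)
      else if \<tau> = 0 then sine_fun \<rho> z
      else - integral {\<rho>..1/2} (\<lambda>u. 2 * cos (pi * u * of_int z) / cos (pi * u) powi \<tau>))"

definition eq_kernel :: "real \<Rightarrow> int \<Rightarrow> int \<Rightarrow> int \<Rightarrow> int \<Rightarrow> complex" where
  "eq_kernel \<rho> s x t y =
     (if even (s + x) \<and> even (t + y) then complex_of_real (eq_fun \<rho> (t - s) (y - x)) else 0)"

definition fdd :: "'w measure \<Rightarrow> ('t \<Rightarrow> 'w \<Rightarrow> int set) \<Rightarrow> 't set \<Rightarrow> ('t \<Rightarrow> int set) measure" where
  "fdd M X J = distr M (PiM J (\<lambda>_. config_borel)) (\<lambda>\<omega>. \<lambda>t\<in>J. X t \<omega>)"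

text \<open>
  \<open>P\<close> is the law, on the space of paths indexed by the integers, of the limit of the shifted
  processes \<open>\<Xi>(2n + t)\<close>. For a finite set \<open>J\<close> of times, \<open>2n + t \<ge> 0\<close> on \<open>J\<close> for all large
  \<open>n\<close>, so the truncation by \<open>nat\<close> does not affect the limit.
\<close>

definition equilibrium_limit ::
    "'w measure \<Rightarrow> (nat \<Rightarrow> 'w \<Rightarrow> int set) \<Rightarrow> (int \<Rightarrow> int set) measure \<Rightarrow> bool" where
  "equilibrium_limit M \<Xi> P \<longleftrightarrow>
     prob_space P \<and> sets P = sets (PiM UNIV (\<lambda>_ :: int. config_borel)) \<and>
     (\<forall>J. finite J \<longrightarrow>
        weakly_converges (product_topology (\<lambda>_. vague_topology) J)
          (\<lambda>n. fdd M (\<lambda>t. \<Xi> (nat (2 * int n + t))) J)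
          (fdd P (\<lambda>t \<omega>. \<omega> t) J))"

definition time_reversible :: "(int \<Rightarrow> int set) measure \<Rightarrow> bool" where
  "time_reversible P \<longleftrightarrow>
     (\<forall>J. finite J \<longrightarrow> fdd P (\<lambda>t \<omega>. \<omega> (- t)) J = fdd P (\<lambda>t \<omega>. \<omega> t) J)"

end

(*
  Expanding the transition probabilities in characters and applying Poisson summation over the
  initial lattice, the correlation kernel becomes a sum of a integrals, indexed by m < a, of
  cos(theta - pi m / a)^s / cos(theta)^t over |theta| <= pi / (2a).  The term m = 0 depends on the
  times only through t - s and, together with the subtracted transition probability, is the
  equilibrium kernel; in the other terms |cos(theta - pi m / a)| < cos(theta), so they vanish by
  dominated convergence when both times are shifted by 2n.  Hence all correlation functions
  converge.  On the compact space of configurations every continuous function is uniformly close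
  to one depending on finitely many sites, so convergence of correlations is weak convergence.
  The limit law exists by Kolmogorov's theorem, and its marginals at times 0 and 1 are the sine
  processes, which are unique.  Reversing time transposes the equilibrium kernel, which leaves its
  determinants unchanged.
*)
theory Submission
  imports Defs "HOL-Library.Real_Mod"
begin

subsection \<open>The space of configurations\<close>

text \<open>A kernel prescribes only the probabilities that given sites are all occupied.
  Inclusion-exclusion turns these into probabilities of complete occupied/empty patterns on finite
  windows, and weak convergence and the existence of the limit are settled at the level of patterns.
  No determinant of the equilibrium kernel is ever shown to be nonnegative, and no general existence
  theorem for determinantal processes enters: positivity and consistency of the limit law are
  inherited from the laws of the given process, and the sine processes are obtained as its
  marginals. There are a characters and not 2a because s + x is even: divisibility by 2a becomes a
  question modulo a about half of s + x - 2k. The hypothesis a >= 2 keeps the angle l / (2a) within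
  pi / 4, so that the cosine in the denominator stays away from zero. As \<open>nat\<close>
  truncates negative times, the identities for shifted times are established for large n only, which
  is enough for limits.\<close>

lemma generator_openin_vague:
  assumes "finite {x. \<phi> x \<noteq> (0::real)}" "open U"
  shows "openin vague_topology {\<xi>. (\<Sum>x | x \<in> \<xi> \<and> \<phi> x \<noteq> 0. \<phi> x) \<in> U}"
  unfolding vague_topology_def openin_topology_generated_by_iff
  by (rule generate_topology_on.Basis) (use assms in blast)

lemma topspace_vague [simp]: "topspace vague_topology = UNIV"
proof -
  \<comment> \<open>The zero test function with \<open>U = UNIV\<close> is a legitimate generator,
    and it yields the whole space.\<close>
  have "openin vague_topology {\<xi>. (\<Sum>x | x \<in> \<xi> \<and> (0::real) \<noteq> 0. 0) \<in> (UNIV::real set)}"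
    by (rule generator_openin_vague) auto
  then have "openin vague_topology UNIV" by simp
  from openin_subset[OF this] show ?thesis by auto
qed

lemma openin_vague_mem: "openin vague_topology {\<xi>. x \<in> \<xi>}"
  and openin_vague_not_mem: "openin vague_topology {\<xi>. x \<notin> \<xi>}"
proof -
  \<comment> \<open>The integral of the indicator of a single site is 0 or 1; half-lines cut at 1/2
    separate the two values.\<close>
  define \<phi> :: "int \<Rightarrow> real" where "\<phi> y = (if y = x then 1 else 0)" for y
  have sum: "(\<Sum>y | y \<in> \<xi> \<and> \<phi> y \<noteq> 0. \<phi> y) = (if x \<in> \<xi> then 1 else 0)" for \<xi>
  proof -
    have "{y. y \<in> \<xi> \<and> \<phi> y \<noteq> 0} = (if x \<in> \<xi> then {x} else {})"
      by (auto simp: \<phi>_def)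
    then show ?thesis by (auto simp: \<phi>_def)
  qed
  have fin: "finite {y. \<phi> y \<noteq> 0}" by (simp add: \<phi>_def)
  have "{\<xi>. x \<in> \<xi>} = {\<xi>. (if x \<in> \<xi> then 1 else 0) \<in> {1/2::real<..}}"
    "{\<xi>. x \<notin> \<xi>} = {\<xi>. (if x \<in> \<xi> then 1 else 0) \<in> {..<1/2::real}}" by auto
  then show "openin vague_topology {\<xi>. x \<in> \<xi>}" "openin vague_topology {\<xi>. x \<notin> \<xi>}"
    using generator_openin_vague[OF fin, of "{1/2<..}"]
      generator_openin_vague[OF fin, of "{..<1/2}"] unfolding sum by auto
qed

lemma openin_vague_cylinder:
  assumes "finite F"
  shows "openin vague_topology {\<eta>. \<forall>x\<in>F. x \<in> \<eta> \<longleftrightarrow> x \<in> \<xi>}"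
proof (cases "F = {}")
  case True
  then show ?thesis using openin_topspace[of vague_topology] by simp
next
  case False
  have "openin vague_topology (\<Inter>x\<in>F. if x \<in> \<xi> then {\<eta>. x \<in> \<eta>} else {\<eta>. x \<notin> \<eta>})"
    by (rule openin_Inter) (use assms False openin_vague_mem openin_vague_not_mem in auto)
  also have "(\<Inter>x\<in>F. if x \<in> \<xi> then {\<eta>. x \<in> \<eta>} else {\<eta>. x \<notin> \<eta>}) = {\<eta>. \<forall>x\<in>F. x \<in> \<eta> \<longleftrightarrow> x \<in> \<xi>}"
    by (auto split: if_splits)
  finally show ?thesis .
qed

text \<open>A finitely supported test function reads finitely many sites, so the vague topology is a
  product of two-point spaces, with the patterns on finite windows as a basis. Compactness, the
  Borel sets and products over times are all treated through this form.\<close>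

lemma openin_vague_iff:
  "openin vague_topology U \<longleftrightarrow> (\<forall>\<xi>\<in>U. \<exists>F. finite F \<and> {\<eta>. \<forall>x\<in>F. x \<in> \<eta> \<longleftrightarrow> x \<in> \<xi>} \<subseteq> U)"
proof
  assume "openin vague_topology U"
  then have "generate_topology_on
     {{\<xi>. (\<Sum>x | x \<in> \<xi> \<and> \<phi> x \<noteq> 0. \<phi> x) \<in> U} | (\<phi> :: int \<Rightarrow> real) U.
        finite {x. \<phi> x \<noteq> 0} \<and> open U} U"
    by (simp add: vague_topology_def openin_topology_generated_by_iff)
  then show "\<forall>\<xi>\<in>U. \<exists>F. finite F \<and> {\<eta>. \<forall>x\<in>F. x \<in> \<eta> \<longleftrightarrow> x \<in> \<xi>} \<subseteq> U"
  proof induction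
    case Empty then show ?case by simp
  next
    case (Int a b)
    show ?case
    proof
      fix \<xi> assume \<xi>: "\<xi> \<in> a \<inter> b"
      from bspec[OF Int.IH(1) IntD1[OF \<xi>]] obtain F
        where F: "finite F \<and> {\<eta>. \<forall>x\<in>F. x \<in> \<eta> \<longleftrightarrow> x \<in> \<xi>} \<subseteq> a" ..
      from bspec[OF Int.IH(2) IntD2[OF \<xi>]] obtain G
        where G: "finite G \<and> {\<eta>. \<forall>x\<in>G. x \<in> \<eta> \<longleftrightarrow> x \<in> \<xi>} \<subseteq> b" ..
      have "{\<eta>. \<forall>x\<in>F \<union> G. x \<in> \<eta> \<longleftrightarrow> x \<in> \<xi>} \<subseteq> a \<inter> b"
        using F G by (simp add: subset_iff)
      with F G show "\<exists>F. finite F \<and> {\<eta>. \<forall>x\<in>F. x \<in> \<eta> \<longleftrightarrow> x \<in> \<xi>} \<subseteq> a \<inter> b"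
        by (intro exI[of _ "F \<union> G"]) simp
    qed
  next
    case (UN K) then show ?case by (meson UnionE Union_upper subset_trans)
  next
    case (Basis s)
    then obtain \<phi> :: "int \<Rightarrow> real" and V where s: "s = {\<xi>. (\<Sum>x | x \<in> \<xi> \<and> \<phi> x \<noteq> 0. \<phi> x) \<in> V}"
      "finite {x. \<phi> x \<noteq> 0}" by blast
    show ?case
    proof
      fix \<xi> assume "\<xi> \<in> s"
      have "\<eta> \<in> s" if "\<forall>x\<in>{x. \<phi> x \<noteq> 0}. x \<in> \<eta> \<longleftrightarrow> x \<in> \<xi>" for \<eta>
      proof -
        have "{x. x \<in> \<eta> \<and> \<phi> x \<noteq> 0} = {x. x \<in> \<xi> \<and> \<phi> x \<noteq> 0}" using that by blast
        with \<open>\<xi> \<in> s\<close> show ?thesis by (simp add: s)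
      qed
      with s(2) show "\<exists>F. finite F \<and> {\<eta>. \<forall>x\<in>F. x \<in> \<eta> \<longleftrightarrow> x \<in> \<xi>} \<subseteq> s"
        by (intro exI[of _ "{x. \<phi> x \<noteq> 0}"]) blast
    qed
  qed
next
  assume R: "\<forall>\<xi>\<in>U. \<exists>F. finite F \<and> {\<eta>. \<forall>x\<in>F. x \<in> \<eta> \<longleftrightarrow> x \<in> \<xi>} \<subseteq> U"
  show "openin vague_topology U"
  proof (subst openin_subopen, intro ballI)
    fix \<xi> assume "\<xi> \<in> U"
    from bspec[OF R this] obtain F where F: "finite F \<and> {\<eta>. \<forall>x\<in>F. x \<in> \<eta> \<longleftrightarrow> x \<in> \<xi>} \<subseteq> U" ..
    then show "\<exists>T. openin vague_topology T \<and> \<xi> \<in> T \<and> T \<subseteq> U"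
      by (intro exI[of _ "{\<eta>. \<forall>x\<in>F. x \<in> \<eta> \<longleftrightarrow> x \<in> \<xi>}"]) (simp add: openin_vague_cylinder)
  qed
qed

text \<open>Tychonoff's theorem makes the power of the discrete two-point space compact, and reading
  a Boolean function as the set where it holds is a continuous surjection onto the configurations.
  For continuity, a preimage contains with each g the box that fixes g on a finite window.\<close>

lemma compact_space_vague: "compact_space vague_topology"
proof -
  let ?T = "product_topology (\<lambda>_::int. discrete_topology (UNIV::bool set)) UNIV"
  have "compact_space ?T"
    by (simp add: compact_space_product_topology compact_space_discrete_topology)
  moreover have "continuous_map ?T vague_topology (\<lambda>g. {x. g x})"
    unfolding continuous_map_def
  proof (intro conjI allI impI)
    fix U assume U: "openin vague_topology U"
    show "openin ?T {g \<in> topspace ?T. {x. g x} \<in> U}"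
    proof (subst openin_subopen, intro ballI)
      fix g assume "g \<in> {g \<in> topspace ?T. {x. g x} \<in> U}"
      then have "{x. g x} \<in> U" by simp
      from bspec[OF U[unfolded openin_vague_iff] this] obtain F
        where F: "finite F \<and> {\<eta>. \<forall>x\<in>F. x \<in> \<eta> \<longleftrightarrow> x \<in> {x. g x}} \<subseteq> U" ..
      let ?B = "PiE UNIV (\<lambda>i. if i \<in> F then {g i} else UNIV)"
      have "openin ?T ?B"
        using F by (subst openin_PiE_gen) (auto intro!: disjI2 elim: rev_finite_subset)
      moreover have "g \<in> ?B" by auto
      moreover have "?B \<subseteq> {g \<in> topspace ?T. {x. g x} \<in> U}"
      proof
        fix h assume h: "h \<in> ?B"
        have "h i = g i" if "i \<in> F" for i using PiE_mem[OF h UNIV_I, of i] that by simp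
        then have "{x. h x} \<in> {\<eta>. \<forall>x\<in>F. x \<in> \<eta> \<longleftrightarrow> x \<in> {x. g x}}" by simp
        with F have "{x. h x} \<in> U" by blast
        then show "h \<in> {g \<in> topspace ?T. {x. g x} \<in> U}" by simp
      qed
      ultimately show "\<exists>T. openin ?T T \<and> g \<in> T \<and> T \<subseteq> {g \<in> topspace ?T. {x. g x} \<in> U}"
        by (intro exI conjI)
    qed
  qed auto
  ultimately have "compactin vague_topology ((\<lambda>g. {x. g x}) ` topspace ?T)"
    by (metis image_compactin compact_space_def)
  moreover have "(\<lambda>g. {x. g x}) ` topspace ?T = UNIV"
  proof -
    have "\<xi> \<in> (\<lambda>g. {x. g x}) ` topspace ?T" for \<xi>
      by (rule image_eqI[of _ _ "\<lambda>x. x \<in> \<xi>"]) auto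
    then show ?thesis by blast
  qed
  ultimately show ?thesis by (simp add: compact_space_def)
qed

lemma openin_product_vague_cylinder:
  assumes "finite J" "finite F"
  shows "openin (product_topology (\<lambda>_. vague_topology) J)
    {\<eta> \<in> PiE J (\<lambda>_. UNIV). \<forall>t\<in>J. \<forall>x\<in>F. x \<in> \<eta> t \<longleftrightarrow> x \<in> \<omega> t}"
proof -
  have "{\<eta> \<in> PiE J (\<lambda>_. UNIV). \<forall>t\<in>J. \<forall>x\<in>F. x \<in> \<eta> t \<longleftrightarrow> x \<in> \<omega> t} =
      PiE J (\<lambda>t. {\<eta>. \<forall>x\<in>F. x \<in> \<eta> \<longleftrightarrow> x \<in> \<omega> t})"
    by (simp add: set_eq_iff[where A = "Collect _"] PiE_iff conj_commute)
  then show ?thesis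
    using assms by (simp add: openin_PiE openin_vague_cylinder)
qed

text \<open>A basic neighbourhood in the product has its own window at each time. As
  \<open>J\<close> is finite, the union of these windows is finite and serves all times at
  once.\<close>

lemma openin_product_vague_subset:
  assumes "finite J" "openin (product_topology (\<lambda>_. vague_topology) J) U" "\<omega> \<in> U"
  shows "\<exists>F. finite F \<and> {\<eta> \<in> PiE J (\<lambda>_. UNIV). \<forall>t\<in>J. \<forall>x\<in>F. x \<in> \<eta> t \<longleftrightarrow> x \<in> \<omega> t} \<subseteq> U"
proof -
  obtain V where V: "\<forall>t\<in>J. openin vague_topology (V t)" "\<omega> \<in> PiE J V" "PiE J V \<subseteq> U"
    using bspec[OF assms(2)[unfolded openin_product_topology_alt] assms(3)] by (elim exE conjE)
  have "\<forall>t\<in>J. \<exists>F. finite F \<and> {\<eta>. \<forall>x\<in>F. x \<in> \<eta> \<longleftrightarrow> x \<in> \<omega> t} \<subseteq> V t"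
  proof
    fix t assume t: "t \<in> J"
    with V(2) have "\<omega> t \<in> V t" by blast
    from bspec[OF bspec[OF V(1) t, unfolded openin_vague_iff] this]
    show "\<exists>F. finite F \<and> {\<eta>. \<forall>x\<in>F. x \<in> \<eta> \<longleftrightarrow> x \<in> \<omega> t} \<subseteq> V t" .
  qed
  from bchoice[OF this] obtain F
    where F: "\<forall>t\<in>J. finite (F t) \<and> {\<eta>. \<forall>x\<in>F t. x \<in> \<eta> \<longleftrightarrow> x \<in> \<omega> t} \<subseteq> V t" ..
  show ?thesis
  proof (intro exI conjI)
    show "finite (\<Union>t\<in>J. F t)" using assms(1) F by blast
    show "{\<eta> \<in> PiE J (\<lambda>_. UNIV). \<forall>t\<in>J. \<forall>x\<in>\<Union>t\<in>J. F t. x \<in> \<eta> t \<longleftrightarrow> x \<in> \<omega> t} \<subseteq> U"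
    proof
      fix \<eta> assume \<eta>: "\<eta> \<in> {\<eta> \<in> PiE J (\<lambda>_. UNIV). \<forall>t\<in>J. \<forall>x\<in>\<Union>t\<in>J. F t. x \<in> \<eta> t \<longleftrightarrow> x \<in> \<omega> t}"
      have "\<eta> t \<in> V t" if "t \<in> J" for t
      proof -
        have "\<forall>x\<in>F t. x \<in> \<eta> t \<longleftrightarrow> x \<in> \<omega> t" using \<eta> that by simp
        then show ?thesis using bspec[OF F that] by blast
      qed
      with \<eta> have "\<eta> \<in> PiE J V" by (simp add: PiE_iff)
      with V(3) show "\<eta> \<in> U" by blast
    qed
  qed
qed

text \<open>A Lebesgue number argument with windows in place of distances: each point has a window
  on whose cylinder \<open>f\<close> differs from its value at the point by less than \<epsilon>/2,
  and the union of the windows of a finite subcover is the required window.\<close>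

lemma uniform_continuity_vague:
  assumes J: "finite J"
    and f: "continuous_map (product_topology (\<lambda>_. vague_topology) J) euclideanreal f"
    and "\<epsilon> > 0"
  shows "\<exists>F. finite F \<and> (\<forall>\<omega>\<in>PiE J (\<lambda>_. UNIV). \<forall>\<eta>\<in>PiE J (\<lambda>_. UNIV).
      (\<forall>t\<in>J. \<forall>x\<in>F. x \<in> \<eta> t \<longleftrightarrow> x \<in> \<omega> t) \<longrightarrow> \<bar>f \<eta> - f \<omega>\<bar> < \<epsilon>)"
proof -
  let ?X = "product_topology (\<lambda>_. vague_topology) J"
  define T where "T = PiE J (\<lambda>_. UNIV :: int set set)"
  define C where "C F \<omega> = {\<eta> \<in> T. \<forall>t\<in>J. \<forall>x\<in>F. x \<in> \<eta> t \<longleftrightarrow> x \<in> \<omega> t}" for F \<omega>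
  have top: "topspace ?X = T" by (simp add: T_def)
  have C_self: "\<omega> \<in> C F \<omega>" if "\<omega> \<in> T" for F \<omega> using that by (simp add: C_def)
  have C_open: "openin ?X (C F \<omega>)" if "finite F" for F \<omega>
    unfolding C_def T_def using openin_product_vague_cylinder[OF J that] .
  have "\<exists>F. finite F \<and> (\<forall>\<eta>\<in>C F \<omega>. \<bar>f \<eta> - f \<omega>\<bar> < \<epsilon>/2)" if \<omega>: "\<omega> \<in> T" for \<omega>
  proof -
    let ?U = "{\<eta> \<in> T. f \<eta> \<in> ball (f \<omega>) (\<epsilon>/2)}"
    have "openin ?X ?U"
      using openin_continuous_map_preimage[OF f, of "ball (f \<omega>) (\<epsilon>/2)"] by (simp only: top) simp
    moreover have "\<omega> \<in> ?U" using \<omega> \<open>\<epsilon> > 0\<close> by simp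
    ultimately have "\<exists>F. finite F \<and> C F \<omega> \<subseteq> ?U"
      unfolding C_def T_def
      by (intro openin_product_vague_subset[OF J])
    then obtain F where F: "finite F \<and> C F \<omega> \<subseteq> ?U" ..
    have "\<bar>f \<eta> - f \<omega>\<bar> < \<epsilon>/2" if "\<eta> \<in> C F \<omega>" for \<eta>
      using subsetD[OF conjunct2[OF F] that] by (simp add: dist_real_def abs_minus_commute)
    with F show ?thesis by blast
  qed
  then have "\<forall>\<omega>\<in>T. \<exists>F. finite F \<and> (\<forall>\<eta>\<in>C F \<omega>. \<bar>f \<eta> - f \<omega>\<bar> < \<epsilon>/2)" ..
  from bchoice[OF this] obtain F
    where F: "\<forall>\<omega>\<in>T. finite (F \<omega>) \<and> (\<forall>\<eta>\<in>C (F \<omega>) \<omega>. \<bar>f \<eta> - f \<omega>\<bar> < \<epsilon>/2)" ..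
  have "compact_space ?X"
    by (simp add: compact_space_product_topology compact_space_vague)
  then have "compactin ?X T" by (simp only: compact_space_def top)
  moreover have "T \<subseteq> \<Union> ((\<lambda>\<omega>. C (F \<omega>) \<omega>) ` T)" using C_self by blast
  moreover have "openin ?X U" if "U \<in> (\<lambda>\<omega>. C (F \<omega>) \<omega>) ` T" for U
    using that F C_open by blast
  ultimately obtain \<F> where \<F>: "finite \<F>" "\<F> \<subseteq> (\<lambda>\<omega>. C (F \<omega>) \<omega>) ` T" "T \<subseteq> \<Union>\<F>"
    using compactinD[of ?X T "(\<lambda>\<omega>. C (F \<omega>) \<omega>) ` T"] by blast
  then obtain W where W: "W \<subseteq> T" "finite W" "\<F> = (\<lambda>\<omega>. C (F \<omega>) \<omega>) ` W"
    by (meson finite_subset_image)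
  have close: "\<bar>f \<eta> - f \<omega>\<bar> < \<epsilon>" if \<omega>: "\<omega> \<in> T" and \<eta>: "\<eta> \<in> T"
      and eq: "\<forall>t\<in>J. \<forall>x\<in>\<Union>w\<in>W. F w. x \<in> \<eta> t \<longleftrightarrow> x \<in> \<omega> t" for \<omega> \<eta>
  proof -
    \<comment> \<open>The cylinder around \<open>w\<close> contains \<omega>, hence also \<eta>,
      which agrees with \<omega> on the window of \<open>w\<close>. Both values are within
      \<epsilon>/2 of \<open>f w\<close>.\<close>
    obtain w where w: "w \<in> W" "\<omega> \<in> C (F w) w" using \<F>(3) W(3) \<omega> by blast
    have "\<forall>t\<in>J. \<forall>x\<in>F w. x \<in> \<eta> t \<longleftrightarrow> x \<in> \<omega> t"
      using eq w(1) by simp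
    with w(2) \<eta> have "\<eta> \<in> C (F w) w" by (simp add: C_def)
    then have "\<bar>f \<omega> - f w\<bar> < \<epsilon>/2" "\<bar>f \<eta> - f w\<bar> < \<epsilon>/2" using w W(1) F by blast+
    then show ?thesis by linarith
  qed
  show ?thesis
  proof (intro exI[of _ "\<Union>w\<in>W. F w"] conjI ballI impI)
    show "finite (\<Union>w\<in>W. F w)" using W F by blast
    fix \<omega> \<eta> assume \<omega>: "\<omega> \<in> PiE J (\<lambda>_. UNIV)" and \<eta>: "\<eta> \<in> PiE J (\<lambda>_. UNIV)"
      and eq: "\<forall>t\<in>J. \<forall>x\<in>\<Union>w\<in>W. F w. x \<in> \<eta> t \<longleftrightarrow> x \<in> \<omega> t"
    from \<omega> \<eta> have "\<omega> \<in> T" "\<eta> \<in> T" by (simp_all only: T_def)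
    then show "\<bar>f \<eta> - f \<omega>\<bar> < \<epsilon>" using eq by (rule close)
  qed
qed

section \<open>Borel sets, cylinder functions and weak convergence\<close>

lemma space_config_borel [simp]: "space config_borel = UNIV"
  by (simp add: config_borel_def)

text \<open>Every open set is a union of cylinders, and there are only countably many of these,
  since window and pattern range over finite sets of integers. The generator is chosen because it is
  closed under finite intersections and consists of the events whose probabilities a kernel
  prescribes.\<close>

lemma sets_config_borel:
  "sets config_borel = sigma_sets UNIV {{\<xi>. F \<subseteq> \<xi>} | F. finite F}" (is "_ = sigma_sets UNIV ?G")
proof -
  have "sigma_sets UNIV {U. openin vague_topology U} = sigma_sets UNIV ?G"
  proof (rule sigma_sets_eqI)
    fix U assume U: "U \<in> {U. openin vague_topology U}"
    let ?C = "\<lambda>(F, G). {\<eta>. \<forall>x\<in>F. x \<in> \<eta> \<longleftrightarrow> x \<in> G}"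
    let ?I = "{(F, G). finite F \<and> finite G \<and> ?C (F, G) \<subseteq> U}"
    interpret sigma_algebra UNIV "sigma_sets UNIV ?G"
      by (rule sigma_algebra_sigma_sets) simp
    have mem: "{\<eta>. x \<in> \<eta>} \<in> sigma_sets UNIV ?G" for x
      by (rule sigma_sets.Basic) (use finite.emptyI finite.insertI in \<open>force intro!: exI[of _ "{x}"]\<close>)
    have not_mem: "{\<eta>. x \<notin> \<eta>} \<in> sigma_sets UNIV ?G" for x
      using compl_sets[OF mem[of x]] by (simp add: Collect_neg_eq Compl_eq_Diff_UNIV)
    have cyl: "{\<eta>. \<forall>x\<in>F. x \<in> \<eta> \<longleftrightarrow> x \<in> G} \<in> sigma_sets UNIV ?G" if "finite F" for F G
      using that
    proof (induction F rule: finite_induct)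
      case empty
      then show ?case using top by simp
    next
      case (insert a F)
      have "{\<eta>. \<forall>x\<in>insert a F. x \<in> \<eta> \<longleftrightarrow> x \<in> G} =
          (if a \<in> G then {\<eta>. a \<in> \<eta>} else {\<eta>. a \<notin> \<eta>}) \<inter> {\<eta>. \<forall>x\<in>F. x \<in> \<eta> \<longleftrightarrow> x \<in> G}"
        by auto
      then show ?case using insert.IH mem not_mem by (simp add: Int)
    qed
    have "countable ?I"
    proof (rule countable_subset)
      show "?I \<subseteq> {F. finite F} \<times> {F. finite F}" by blast
      show "countable ({F :: int set. finite F} \<times> {F :: int set. finite F})"
        using countable_Collect_finite[where 'a=int] by (intro countable_SIGMA) auto
    qed
    then have "(\<Union>i\<in>?I. ?C i) \<in> sigma_sets UNIV ?G"
      by (rule countable_UN'') (use cyl in auto)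
    also have "(\<Union>i\<in>?I. ?C i) = U"
    proof (intro equalityI subsetI)
      fix \<xi> assume \<xi>: "\<xi> \<in> U"
      from bspec[OF U[unfolded mem_Collect_eq openin_vague_iff] this] obtain F
        where F: "finite F \<and> {\<eta>. \<forall>x\<in>F. x \<in> \<eta> \<longleftrightarrow> x \<in> \<xi>} \<subseteq> U" ..
      \<comment> \<open>Recording the pattern of \<xi> as the finite set
        \<open>F \<inter> \<xi>\<close> is what keeps the index set \<open>?I\<close>
        countable.\<close>
      have eq: "{\<eta>. \<forall>x\<in>F. x \<in> \<eta> \<longleftrightarrow> x \<in> F \<inter> \<xi>} = {\<eta>. \<forall>x\<in>F. x \<in> \<eta> \<longleftrightarrow> x \<in> \<xi>}" by simp
      have "(F, F \<inter> \<xi>) \<in> ?I" using F unfolding mem_Collect_eq prod.case eq by simp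
      moreover have "\<xi> \<in> ?C (F, F \<inter> \<xi>)" by simp
      ultimately show "\<xi> \<in> (\<Union>i\<in>?I. ?C i)" by (rule UN_I)
    qed auto
    finally show "U \<in> sigma_sets UNIV ?G" .
  next
    fix B assume "B \<in> ?G"
    then obtain F where F: "B = {\<xi>. F \<subseteq> \<xi>}" "finite F" by blast
    have "B = {\<xi>. \<forall>x\<in>F. x \<in> \<xi> \<longleftrightarrow> x \<in> F}" using F(1) by auto
    then have "openin vague_topology B" using F(2) by (simp only: openin_vague_cylinder)
    then show "B \<in> sigma_sets UNIV {U. openin vague_topology U}" by (simp add: sigma_sets.Basic)
  qed
  then show ?thesis by (simp add: config_borel_def)
qed

lemma sets_config_borel_mem [measurable]: "{\<xi>. x \<in> \<xi>} \<in> sets config_borel"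
proof -
  have "{\<xi>. x \<in> \<xi>} = {\<xi>. {x} \<subseteq> \<xi>}" by simp
  then show ?thesis unfolding sets_config_borel by (intro sigma_sets.Basic) blast
qed

lemma measurable_mem_config [measurable]:
  assumes "f \<in> measurable M config_borel"
  shows "Measurable.pred M (\<lambda>\<omega>. x \<in> f \<omega>)"
proof -
  have "(\<lambda>\<xi>. x \<in> \<xi>) \<in> measurable config_borel (count_space UNIV)"
    by (simp add: pred_def sets_config_borel_mem)
  from measurable_compose[OF assms this] show ?thesis .
qed

lemma measurable_config_borelI:
  assumes "\<And>x. Measurable.pred M (\<lambda>\<omega>. x \<in> f \<omega>)"
  shows "f \<in> measurable M config_borel"
proof (rule measurable_sigma_sets[OF sets_config_borel])
  fix B assume "B \<in> {{\<xi>. F \<subseteq> \<xi>} | F :: int set. finite F}"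
  then obtain F where F: "B = {\<xi>. F \<subseteq> \<xi>}" "finite F" by blast
  have "f -` B \<inter> space M = {\<omega> \<in> space M. \<forall>x\<in>F. x \<in> f \<omega>}" using F by auto
  also have "\<dots> \<in> sets M"
    using F(2) assms by (intro sets.sets_Collect_finite_All) (auto simp: pred_def)
  finally show "f -` B \<inter> space M \<in> sets M" .
qed auto

text \<open>Forbidding one more event \<open>b\<close> subtracts the probability with
  \<open>b\<close> moved into \<open>A\<close>, and the subsets of \<open>insert b B\<close> split
  according to whether they contain \<open>b\<close>. This is the bridge from correlations to
  probabilities of patterns.\<close>

lemma (in finite_measure) measure_inclusion_exclusion:
  assumes "finite A" "finite B" "A \<subseteq> I" "B \<subseteq> I" and Q: "\<And>i. i \<in> I \<Longrightarrow> Measurable.pred M (Q i)"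
  shows "measure M {\<omega> \<in> space M. (\<forall>i\<in>A. Q i \<omega>) \<and> (\<forall>i\<in>B. \<not> Q i \<omega>)} =
    (\<Sum>C\<in>Pow B. (-1) ^ card C * measure M {\<omega> \<in> space M. \<forall>i\<in>A \<union> C. Q i \<omega>})"
  using assms(2,1,3,4)
proof (induction B arbitrary: A rule: finite_induct)
  case empty
  then show ?case by simp
next
  case (insert b B)
  let ?E = "\<lambda>A B. {\<omega> \<in> space M. (\<forall>i\<in>A. Q i \<omega>) \<and> (\<forall>i\<in>B. \<not> Q i \<omega>)}"
  have meas: "?E A B \<in> sets M" if "finite A" "finite B" "A \<subseteq> I" "B \<subseteq> I" for A B
    using that Q by (intro sets.sets_Collect_conj sets.sets_Collect_finite_All sets.sets_Collect_neg) (auto simp: pred_def subset_iff)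
  have eq: "?E A (insert b B) = ?E A B - ?E (insert b A) B" by auto
  have "measure M (?E A B - ?E (insert b A) B) = measure M (?E A B) - measure M (?E (insert b A) B)"
    using insert.hyps insert.prems by (intro finite_measure_Diff meas) auto
  then have "measure M (?E A (insert b B)) = measure M (?E A B) - measure M (?E (insert b A) B)"
    unfolding eq .
  also have "\<dots> = (\<Sum>C\<in>Pow B. (-1) ^ card C * measure M {\<omega> \<in> space M. \<forall>i\<in>A \<union> C. Q i \<omega>}) +
      (\<Sum>C\<in>Pow B. (-1) ^ card (insert b C) * measure M {\<omega> \<in> space M. \<forall>i\<in>A \<union> insert b C. Q i \<omega>})"
  proof -
    have "card (insert b C) = Suc (card C)" if "C \<in> Pow B" for C
      using that insert.hyps by (intro card_insert_disjoint) (auto dest: finite_subset)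
    then have "(\<Sum>C\<in>Pow B. (-1) ^ card (insert b C) * measure M {\<omega> \<in> space M. \<forall>i\<in>A \<union> insert b C. Q i \<omega>}) =
        (\<Sum>C\<in>Pow B. - ((-1) ^ card C * measure M {\<omega> \<in> space M. \<forall>i\<in>insert b A \<union> C. Q i \<omega>}))"
      by (intro sum.cong) simp_all
    also have "\<dots> = - (\<Sum>C\<in>Pow B. (-1) ^ card C * measure M {\<omega> \<in> space M. \<forall>i\<in>insert b A \<union> C. Q i \<omega>})"
      by (rule sum_negf)
    also have "(\<Sum>C\<in>Pow B. (-1) ^ card C * measure M {\<omega> \<in> space M. \<forall>i\<in>insert b A \<union> C. Q i \<omega>}) =
        measure M (?E (insert b A) B)"
      by (rule insert.IH[symmetric]) (use insert.prems in auto)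
    finally have "(\<Sum>C\<in>Pow B. (-1) ^ card (insert b C) * measure M {\<omega> \<in> space M. \<forall>i\<in>A \<union> insert b C. Q i \<omega>}) =
        - measure M (?E (insert b A) B)" .
    moreover have "(\<Sum>C\<in>Pow B. (-1) ^ card C * measure M {\<omega> \<in> space M. \<forall>i\<in>A \<union> C. Q i \<omega>}) =
        measure M (?E A B)"
      by (rule insert.IH[symmetric]) (use insert.prems in auto)
    ultimately show ?thesis by linarith
  qed
  also have "\<dots> = (\<Sum>C\<in>Pow (insert b B). (-1) ^ card C * measure M {\<omega> \<in> space M. \<forall>i\<in>A \<union> C. Q i \<omega>})"
  proof -
    have "inj_on (insert b) (Pow B)" using insert.hyps by (intro inj_onI) (blast elim: equalityE)
    moreover have "Pow B \<inter> insert b ` Pow B = {}" using insert.hyps by auto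
    ultimately show ?thesis
      using insert.hyps by (simp add: Pow_insert sum.union_disjoint sum.reindex)
  qed
  finally show ?case .
qed

text \<open>Configurations are frozen outside a finite window: \<open>c S\<close> is the value of
  \<open>f\<close> at the path whose points are exactly those of \<open>S\<close>. The cells indexed
  by \<open>Pow G\<close> partition the paths, so exactly one indicator is 1, and the error is
  controlled by the oscillation of \<open>f\<close> on a cell.\<close>

lemma cylinder_approximation:
  assumes J: "finite J"
    and f: "continuous_map (product_topology (\<lambda>_. vague_topology) J) euclideanreal f"
    and "\<epsilon> > 0"
  shows "\<exists>G c. finite G \<and> G \<subseteq> J \<times> UNIV \<and> (\<forall>\<omega>\<in>PiE J (\<lambda>_. UNIV).
    \<bar>f \<omega> - (\<Sum>S\<in>Pow G. c S * indicator {\<omega>. (\<forall>z\<in>S. snd z \<in> \<omega> (fst z)) \<and> (\<forall>z\<in>G - S. snd z \<notin> \<omega> (fst z))} \<omega>)\<bar> < \<epsilon>)"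
proof -
  obtain F where F: "finite F \<and> (\<forall>\<omega>\<in>PiE J (\<lambda>_. UNIV). \<forall>\<eta>\<in>PiE J (\<lambda>_. UNIV).
      (\<forall>t\<in>J. \<forall>x\<in>F. x \<in> \<eta> t \<longleftrightarrow> x \<in> \<omega> t) \<longrightarrow> \<bar>f \<eta> - f \<omega>\<bar> < \<epsilon>)"
    using uniform_continuity_vague[OF assms] ..
  define G where "G = J \<times> F"
  define c where "c S = f (\<lambda>t\<in>J. {x. (t, x) \<in> S})" for S
  have finG: "finite G" using J F by (simp add: G_def)
  have "\<bar>f \<omega> - (\<Sum>S\<in>Pow G. c S * indicator {\<omega>. (\<forall>z\<in>S. snd z \<in> \<omega> (fst z)) \<and> (\<forall>z\<in>G - S. snd z \<notin> \<omega> (fst z))} \<omega>)\<bar> < \<epsilon>"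
    if \<omega>: "\<omega> \<in> PiE J (\<lambda>_. UNIV)" for \<omega>
  proof -
    define S0 where "S0 = {z \<in> G. snd z \<in> \<omega> (fst z)}"
    have "(\<Sum>S\<in>Pow G. c S * indicator {\<omega>. (\<forall>z\<in>S. snd z \<in> \<omega> (fst z)) \<and> (\<forall>z\<in>G - S. snd z \<notin> \<omega> (fst z))} \<omega>) =
        (\<Sum>S\<in>Pow G. if S = S0 then c S else 0)"
    proof (rule sum.cong[OF refl])
      fix S assume "S \<in> Pow G"
      then have "(\<forall>z\<in>S. snd z \<in> \<omega> (fst z)) \<and> (\<forall>z\<in>G - S. snd z \<notin> \<omega> (fst z)) \<longleftrightarrow> S = S0"
        unfolding S0_def by blast
      then show "c S * indicator {\<omega>. (\<forall>z\<in>S. snd z \<in> \<omega> (fst z)) \<and> (\<forall>z\<in>G - S. snd z \<notin> \<omega> (fst z))} \<omega> =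
          (if S = S0 then c S else 0)" by (simp only: indicator_def mem_Collect_eq) simp
    qed
    also have "\<dots> = c S0" using finG by (simp add: S0_def)
    finally have "(\<Sum>S\<in>Pow G. c S * indicator {\<omega>. (\<forall>z\<in>S. snd z \<in> \<omega> (fst z)) \<and> (\<forall>z\<in>G - S. snd z \<notin> \<omega> (fst z))} \<omega>) = c S0" .
    moreover have "\<bar>c S0 - f \<omega>\<bar> < \<epsilon>"
      unfolding c_def
      by (rule F[THEN conjunct2, rule_format, OF \<omega>]) (simp_all add: S0_def G_def)
    ultimately show ?thesis by (simp only: abs_minus_commute)
  qed
  moreover have "G \<subseteq> J \<times> UNIV" by (auto simp: G_def)
  ultimately show ?thesis using finG by (intro exI[of _ G] exI[of _ c] conjI ballI)
qed

lemma sets_cylinder: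
  assumes "finite S" "finite T" "S \<union> T \<subseteq> J \<times> UNIV"
  shows "{\<omega> \<in> PiE J (\<lambda>_. UNIV). (\<forall>z\<in>S. snd z \<in> \<omega> (fst z)) \<and> (\<forall>z\<in>T. snd z \<notin> \<omega> (fst z))} \<in> sets (PiM J (\<lambda>_. config_borel))"
proof -
  let ?M = "PiM J (\<lambda>_. config_borel)"
  have "{\<omega> \<in> space ?M. snd z \<in> \<omega> (fst z)} \<in> sets ?M" if "z \<in> S \<union> T" for z
    using measurable_mem_config[OF measurable_component_singleton[of "fst z" J]] that assms(3)
    by (auto simp: pred_def)
  then have "{\<omega> \<in> space ?M. (\<forall>z\<in>S. snd z \<in> \<omega> (fst z)) \<and> (\<forall>z\<in>T. snd z \<notin> \<omega> (fst z))} \<in> sets ?M"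
    using assms(1,2)
    by (intro sets.sets_Collect_conj sets.sets_Collect_finite_All sets.sets_Collect_neg) auto
  then show ?thesis by (simp add: space_PiM)
qed

text \<open>\<open>PiM\<close> carries the product of the Borel fields, so measurability does not
  follow from continuity by definition. It follows because \<open>f\<close> is a limit of functions
  of finitely many occupation numbers.\<close>

lemma borel_measurable_continuous_vague:
  assumes J: "finite J"
    and f: "continuous_map (product_topology (\<lambda>_. vague_topology) J) euclideanreal f"
  shows "f \<in> borel_measurable (PiM J (\<lambda>_. config_borel))"
proof -
  let ?g = "\<lambda>G c \<omega>. \<Sum>S\<in>Pow G. c S * indicator {\<omega>. (\<forall>z\<in>S. snd z \<in> \<omega> (fst z)) \<and> (\<forall>z\<in>G - S. snd z \<notin> \<omega> (fst z))} \<omega> :: real"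
  have "\<forall>n. \<exists>g. g \<in> borel_measurable (PiM J (\<lambda>_. config_borel)) \<and>
     (\<forall>\<omega>\<in>PiE J (\<lambda>_. UNIV). \<bar>f \<omega> - g \<omega>\<bar> < 1 / Suc n)"
  proof
    fix n
    obtain G c where G: "finite G" "G \<subseteq> J \<times> UNIV" "\<forall>\<omega>\<in>PiE J (\<lambda>_. UNIV). \<bar>f \<omega> - ?g G c \<omega>\<bar> < 1 / Suc n"
      using cylinder_approximation[OF assms, of "1 / Suc n"] by auto
    have "?g G c \<in> borel_measurable (PiM J (\<lambda>_. config_borel))"
    proof (intro borel_measurable_sum borel_measurable_times borel_measurable_const)
      fix S assume "S \<in> Pow G"
      then have "{\<omega> \<in> PiE J (\<lambda>_. UNIV). (\<forall>z\<in>S. snd z \<in> \<omega> (fst z)) \<and> (\<forall>z\<in>G - S. snd z \<notin> \<omega> (fst z))} \<in> sets (PiM J (\<lambda>_. config_borel))"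
        using G by (intro sets_cylinder) (auto intro: finite_subset)
      then show "indicat_real {\<omega>. (\<forall>z\<in>S. snd z \<in> \<omega> (fst z)) \<and> (\<forall>z\<in>G - S. snd z \<notin> \<omega> (fst z))}
          \<in> borel_measurable (PiM J (\<lambda>_. config_borel))"
        by (subst borel_measurable_indicator_iff) (simp add: space_PiM Int_def conj_commute)
    qed
    with G(3) show "\<exists>g. g \<in> borel_measurable (PiM J (\<lambda>_. config_borel)) \<and>
     (\<forall>\<omega>\<in>PiE J (\<lambda>_. UNIV). \<bar>f \<omega> - g \<omega>\<bar> < 1 / Suc n)" by blast
  qed
  from choice[OF this] obtain g where g: "\<forall>n. g n \<in> borel_measurable (PiM J (\<lambda>_. config_borel)) \<and>
     (\<forall>\<omega>\<in>PiE J (\<lambda>_. UNIV). \<bar>f \<omega> - g n \<omega>\<bar> < 1 / Suc n)" ..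
  show ?thesis
  proof (rule borel_measurable_LIMSEQ_real)
    show "g n \<in> borel_measurable (PiM J (\<lambda>_. config_borel))" for n using g by blast
    fix \<omega> assume "\<omega> \<in> space (PiM J (\<lambda>_. config_borel))"
    then have \<omega>: "\<omega> \<in> PiE J (\<lambda>_. UNIV)" by (simp add: space_PiM)
    have lim: "(\<lambda>n. 1 / real (Suc n)) \<longlonglongrightarrow> 0" by (rule lim_1_over_n[THEN LIMSEQ_Suc])
    have "norm (g n \<omega> - f \<omega>) \<le> 1 / real (Suc n)" for n
    proof -
      have "\<bar>f \<omega> - g n \<omega>\<bar> < 1 / real (Suc n)" using g \<omega> by blast
      then show ?thesis unfolding real_norm_def by linarith
    qed
    from Lim_null_comparison[OF always_eventually[OF allI[OF this]] lim]
    have "(\<lambda>n. g n \<omega> - f \<omega>) \<longlonglongrightarrow> 0" .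
    then show "(\<lambda>n. g n \<omega>) \<longlonglongrightarrow> f \<omega>" by (rule LIM_zero_cancel)
  qed
qed

text \<open>Three errors of \<open>r / 3\<close>: replacing \<open>f\<close> by a cell function
  under \<mu> n, doing so under \<nu>, and comparing the two integrals of the cell function. The
  cell function depends only on \<open>f\<close> and \<open>r\<close>, so its integral is a fixed
  finite combination of cell probabilities and, by inclusion-exclusion, of correlations.\<close>

lemma weakly_converges_correlations:
  fixes \<mu> :: "nat \<Rightarrow> ('t \<Rightarrow> int set) measure"
  assumes J: "finite J"
    and prob: "\<And>n. prob_space (\<mu> n)" "prob_space \<nu>"
    and sets: "\<And>n. sets (\<mu> n) = sets (PiM J (\<lambda>_. config_borel))" "sets \<nu> = sets (PiM J (\<lambda>_. config_borel))"
    and corr: "\<And>A. finite A \<Longrightarrow> A \<subseteq> J \<times> UNIV \<Longrightarrow>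
      (\<lambda>n. measure (\<mu> n) {\<omega> \<in> space (\<mu> n). \<forall>z\<in>A. snd z \<in> \<omega> (fst z)})
        \<longlonglongrightarrow> measure \<nu> {\<omega> \<in> space \<nu>. \<forall>z\<in>A. snd z \<in> \<omega> (fst z)}"
  shows "weakly_converges (product_topology (\<lambda>_. vague_topology) J) \<mu> \<nu>"
  unfolding weakly_converges_def
proof (intro allI impI, elim conjE)
  fix f :: "('t \<Rightarrow> int set) \<Rightarrow> real"
  let ?X = "product_topology (\<lambda>_. vague_topology) J"
  let ?P = "PiM J (\<lambda>_. config_borel)"
  assume f: "continuous_map ?X euclideanreal f" and bdd: "bounded (f ` topspace ?X)"
  let ?C = "\<lambda>G S. {\<omega>. (\<forall>z\<in>S. snd z \<in> \<omega> (fst z)) \<and> (\<forall>z\<in>G - S. snd z \<notin> \<omega> (fst z))}"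
  let ?g = "\<lambda>G c \<omega>. \<Sum>S\<in>Pow G. c S * indicator (?C G S) \<omega> :: real"
  have cell: "?C G S \<inter> space N \<in> sets N"
    if "finite G" "G \<subseteq> J \<times> UNIV" "S \<in> Pow G" "sets N = sets ?P" for G S and N :: "('t \<Rightarrow> int set) measure"
  proof -
    have "{\<omega> \<in> PiE J (\<lambda>_. UNIV). (\<forall>z\<in>S. snd z \<in> \<omega> (fst z)) \<and> (\<forall>z\<in>G - S. snd z \<notin> \<omega> (fst z))} \<in> sets ?P"
      using that by (intro sets_cylinder) (auto intro: finite_subset)
    then show ?thesis
      using sets_eq_imp_space_eq[OF that(4)] that(4) by (simp add: space_PiM Int_def conj_commute)
  qed
  obtain b where b: "\<And>\<omega>. \<omega> \<in> PiE J (\<lambda>_. UNIV) \<Longrightarrow> \<bar>f \<omega>\<bar> \<le> b"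
    using bdd unfolding bounded_iff by auto
  have approx: "\<bar>(\<integral>\<omega>. f \<omega> \<partial>N) - (\<Sum>S\<in>Pow G. c S * measure N (?C G S \<inter> space N))\<bar> \<le> \<epsilon>"
    if G: "finite G" "G \<subseteq> J \<times> UNIV" and close: "\<forall>\<omega>\<in>PiE J (\<lambda>_. UNIV). \<bar>f \<omega> - ?g G c \<omega>\<bar> < \<epsilon>"
      and N: "prob_space N" "sets N = sets ?P" for G c \<epsilon> N
  proof -
    interpret prob_space N by fact
    have sp: "space N = PiE J (\<lambda>_. UNIV)" using sets_eq_imp_space_eq[OF N(2)] by (simp add: space_PiM)
    have ind: "integrable N (indicat_real (?C G S))" if "S \<in> Pow G" for S
      using cell[OF G that N(2)] by (subst integrable_indicator_iff) (auto simp: emeasure_eq_measure)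
    have g: "integrable N (?g G c)"
      using ind by (intro Bochner_Integration.integrable_sum integrable_mult_right) auto
    have "f \<in> borel_measurable N"
      using borel_measurable_continuous_vague[OF J f] measurable_cong_sets[OF N(2) refl] by blast
    then have fi: "integrable N f"
      by (rule integrable_const_bound[where B = b, rotated]) (use b sp in auto)
    have "(\<integral>\<omega>. ?g G c \<omega> \<partial>N) = (\<Sum>S\<in>Pow G. c S * measure N (?C G S \<inter> space N))"
      using ind by (subst Bochner_Integration.integral_sum) (auto intro!: sum.cong)
    then have "\<bar>(\<integral>\<omega>. f \<omega> \<partial>N) - (\<Sum>S\<in>Pow G. c S * measure N (?C G S \<inter> space N))\<bar>
        = \<bar>\<integral>\<omega>. f \<omega> - ?g G c \<omega> \<partial>N\<bar>"
      using fi g by (subst Bochner_Integration.integral_diff) simp_all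
    also have "\<dots> \<le> (\<integral>\<omega>. \<bar>f \<omega> - ?g G c \<omega>\<bar> \<partial>N)" by (rule integral_abs_bound)
    also have "\<dots> \<le> (\<integral>\<omega>. \<epsilon> \<partial>N)"
      using close sp fi g by (intro integral_mono integrable_abs Bochner_Integration.integrable_diff) (auto intro: less_imp_le)
    finally show ?thesis by (simp add: prob_space)
  qed
  have cell_lim: "(\<lambda>n. measure (\<mu> n) (?C G S \<inter> space (\<mu> n))) \<longlonglongrightarrow> measure \<nu> (?C G S \<inter> space \<nu>)"
    if G: "finite G" "G \<subseteq> J \<times> UNIV" "S \<in> Pow G" for G S
  proof -
    have eq: "measure N (?C G S \<inter> space N) =
        (\<Sum>C\<in>Pow (G - S). (-1) ^ card C * measure N {\<omega> \<in> space N. \<forall>z\<in>S \<union> C. snd z \<in> \<omega> (fst z)})"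
      if N: "prob_space N" "sets N = sets ?P" for N
    proof -
      interpret prob_space N by fact
      have "measure N {\<omega> \<in> space N. (\<forall>z\<in>S. snd z \<in> \<omega> (fst z)) \<and> (\<forall>z\<in>G - S. snd z \<notin> \<omega> (fst z))} =
        (\<Sum>C\<in>Pow (G - S). (-1) ^ card C * measure N {\<omega> \<in> space N. \<forall>z\<in>S \<union> C. snd z \<in> \<omega> (fst z)})"
      proof (rule measure_inclusion_exclusion[where I = "J \<times> UNIV"])
        fix z :: "'t \<times> int" assume z: "z \<in> J \<times> UNIV"
        have "Measurable.pred ?P (\<lambda>\<omega>. snd z \<in> \<omega> (fst z))"
          using z by (intro measurable_mem_config measurable_component_singleton) auto
        then show "Measurable.pred N (\<lambda>\<omega>. snd z \<in> \<omega> (fst z))"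
          using measurable_cong_sets[OF N(2) refl] by blast
      qed (use G in \<open>auto intro: finite_subset\<close>)
      then show ?thesis by (simp add: Int_def conj_commute)
    qed
    show ?thesis
      unfolding eq[OF prob(1) sets(1)] eq[OF prob(2) sets(2)]
      by (intro tendsto_intros corr) (use G in \<open>auto intro: finite_subset\<close>)
  qed
  show "(\<lambda>n. \<integral>\<omega>. f \<omega> \<partial>\<mu> n) \<longlonglongrightarrow> (\<integral>\<omega>. f \<omega> \<partial>\<nu>)"
  proof (rule LIMSEQ_I)
    fix r :: real assume "r > 0"
    then obtain G c where G: "finite G" "G \<subseteq> J \<times> UNIV" "\<forall>\<omega>\<in>PiE J (\<lambda>_. UNIV). \<bar>f \<omega> - ?g G c \<omega>\<bar> < r / 3"
      using cylinder_approximation[OF J f, of "r / 3"] by auto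
    let ?s = "\<lambda>N. \<Sum>S\<in>Pow G. c S * measure N (?C G S \<inter> space N)"
    have "(\<lambda>n. ?s (\<mu> n)) \<longlonglongrightarrow> ?s \<nu>"
      by (intro tendsto_intros cell_lim G)
    from LIMSEQ_D[OF this, of "r / 3"] \<open>r > 0\<close> obtain n0
      where n0: "\<And>n. n \<ge> n0 \<Longrightarrow> \<bar>?s (\<mu> n) - ?s \<nu>\<bar> < r / 3" by auto
    have "norm ((\<integral>\<omega>. f \<omega> \<partial>\<mu> n) - (\<integral>\<omega>. f \<omega> \<partial>\<nu>)) < r" if "n \<ge> n0" for n
      using n0[OF that] approx[OF G prob(1) sets(1), of n] approx[OF G prob(2) sets(2)]
      unfolding real_norm_def by linarith
    then show "\<exists>n0. \<forall>n\<ge>n0. norm ((\<integral>\<omega>. f \<omega> \<partial>\<mu> n) - (\<integral>\<omega>. f \<omega> \<partial>\<nu>)) < r" by blast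
  qed
qed

section \<open>Correlations determine laws and are integrals of continuous functions\<close>

lemma continuous_map_vague_indicator:
  "continuous_map vague_topology euclideanreal (\<lambda>\<xi>. indicator \<xi> x)"
  unfolding continuous_map_def
proof (intro conjI allI impI)
  fix U :: "real set"
  show "openin vague_topology {\<xi> \<in> topspace vague_topology. indicator \<xi> x \<in> U}"
    unfolding openin_vague_iff
    by (intro ballI exI[of _ "{x}"]) (auto simp: indicator_def)
qed simp

lemma sets_PiM_config_borel:
  "sets (PiM J (\<lambda>_. config_borel)) = sigma_sets (PiE J (\<lambda>_. UNIV))
     {{\<omega> \<in> PiE J (\<lambda>_. UNIV). \<forall>z\<in>A. snd z \<in> \<omega> (fst z)} | A. finite A \<and> A \<subseteq> J \<times> UNIV}"
  (is "_ = sigma_sets ?\<Omega> ?E")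
proof (rule antisym)
  have E: "?E \<subseteq> Pow ?\<Omega>" by blast
  have "(\<lambda>\<omega>. \<omega> i) \<in> measurable (sigma ?\<Omega> ?E) config_borel" if "i \<in> J" for i
  proof (rule measurable_config_borelI)
    fix x
    have "{\<omega> \<in> ?\<Omega>. x \<in> \<omega> i} = {\<omega> \<in> ?\<Omega>. \<forall>z\<in>{(i, x)}. snd z \<in> \<omega> (fst z)}" by simp
    also have "\<dots> \<in> ?E" using that by (intro CollectI exI[of _ "{(i, x)}"]) simp
    finally show "Measurable.pred (sigma ?\<Omega> ?E) (\<lambda>\<omega>. x \<in> \<omega> i)"
      using E by (simp add: pred_def sigma_sets.Basic)
  qed
  then have "{\<omega> \<in> ?\<Omega>. \<omega> i \<in> B} \<in> sigma_sets ?\<Omega> ?E" if "i \<in> J" "B \<in> sets config_borel" for i B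
    using measurable_sets[of "\<lambda>\<omega>. \<omega> i" "sigma ?\<Omega> ?E" config_borel B] that E
    by (simp add: vimage_def Int_def conj_commute)
  then show "sets (PiM J (\<lambda>_. config_borel)) \<subseteq> sigma_sets ?\<Omega> ?E"
    unfolding sets_PiM_single space_config_borel by (intro sigma_sets_mono) auto
next
  have "X \<in> sets (PiM J (\<lambda>_. config_borel))" if X: "X \<in> ?E" for X
  proof -
    obtain A where A: "X = {\<omega> \<in> ?\<Omega>. \<forall>z\<in>A. snd z \<in> \<omega> (fst z)}" "finite A" "A \<subseteq> J \<times> UNIV"
      using X by auto
    from sets_cylinder[of A "{}" J] A show ?thesis by simp
  qed
  then have "?E \<subseteq> sets (PiM J (\<lambda>_. config_borel))" by (rule subsetI)
  from sets.sigma_sets_subset[OF this]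
  show "sigma_sets ?\<Omega> ?E \<subseteq> sets (PiM J (\<lambda>_. config_borel))"
    by (simp add: space_PiM)
qed

text \<open>The correlation events form an intersection-stable generator that contains the whole
  space, as the case \<open>A = {}\<close>, so Dynkin's uniqueness theorem applies.\<close>

lemma measure_eq_correlations:
  fixes \<mu> \<nu> :: "('t \<Rightarrow> int set) measure"
  assumes "prob_space \<mu>" "prob_space \<nu>"
    and sets: "sets \<mu> = sets (PiM J (\<lambda>_. config_borel))" "sets \<nu> = sets (PiM J (\<lambda>_. config_borel))"
    and corr: "\<And>A. finite A \<Longrightarrow> A \<subseteq> J \<times> UNIV \<Longrightarrow>
      measure \<mu> {\<omega> \<in> space \<mu>. \<forall>z\<in>A. snd z \<in> \<omega> (fst z)} = measure \<nu> {\<omega> \<in> space \<nu>. \<forall>z\<in>A. snd z \<in> \<omega> (fst z)}"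
  shows "\<mu> = \<nu>"
proof -
  interpret \<mu>: prob_space \<mu> by fact
  interpret \<nu>: prob_space \<nu> by fact
  let ?\<Omega> = "PiE J (\<lambda>_. UNIV :: int set set)"
  let ?E = "{{\<omega> \<in> ?\<Omega>. \<forall>z\<in>A. snd z \<in> \<omega> (fst z)} | A. finite A \<and> A \<subseteq> J \<times> UNIV}"
  have space: "space \<mu> = ?\<Omega>" "space \<nu> = ?\<Omega>"
    using sets[THEN sets_eq_imp_space_eq] by (simp_all add: space_PiM)
  have whole: "{\<omega> \<in> ?\<Omega>. \<forall>z\<in>{}. snd z \<in> \<omega> (fst z)} = ?\<Omega>" by simp
  show ?thesis
  proof (rule measure_eqI_generator_eq[where E = ?E and \<Omega> = ?\<Omega> and A = "\<lambda>_. ?\<Omega>"])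
    show "Int_stable ?E"
    proof (rule Int_stableI)
      fix a b assume "a \<in> ?E" "b \<in> ?E"
      then obtain A B where
        "a = {\<omega> \<in> ?\<Omega>. \<forall>z\<in>A. snd z \<in> \<omega> (fst z)}" "finite A" "A \<subseteq> J \<times> UNIV"
        "b = {\<omega> \<in> ?\<Omega>. \<forall>z\<in>B. snd z \<in> \<omega> (fst z)}" "finite B" "B \<subseteq> J \<times> UNIV" by auto
      then show "a \<inter> b \<in> ?E" by (intro CollectI exI[of _ "A \<union> B"]) auto
    qed
    show "range (\<lambda>_. ?\<Omega>) \<subseteq> ?E" using whole by blast
    show "emeasure \<mu> X = emeasure \<nu> X" if "X \<in> ?E" for X
      using that corr by (auto simp: \<mu>.emeasure_eq_measure \<nu>.emeasure_eq_measure space)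
  qed (auto simp: sets sets_PiM_config_borel)
qed

text \<open>Dynkin's theorem for a single configuration. It supplies the uniqueness on which the
  definite description in \<open>mu_sin\<close> rests.\<close>

lemma determinantal_law_unique:
  assumes "determinantal_law \<mu> K" "determinantal_law \<nu> K"
  shows "\<mu> = \<nu>"
proof -
  interpret \<mu>: prob_space \<mu> using assms by (simp add: determinantal_law_def)
  interpret \<nu>: prob_space \<nu> using assms by (simp add: determinantal_law_def)
  have sets: "sets \<mu> = sets config_borel" "sets \<nu> = sets config_borel"
    using assms by (simp_all add: determinantal_law_def)
  then have space: "space \<mu> = UNIV" "space \<nu> = UNIV"
    using sets[THEN sets_eq_imp_space_eq] by simp_all
  let ?E = "{{\<xi>. F \<subseteq> \<xi>} | F :: int set. finite F}"
  show ?thesis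
  proof (rule measure_eqI_generator_eq[where E = ?E and \<Omega> = UNIV and A = "\<lambda>_. UNIV"])
    show "Int_stable ?E"
    proof (rule Int_stableI)
      fix a b assume "a \<in> ?E" "b \<in> ?E"
      then obtain A B where "a = {\<xi>. A \<subseteq> \<xi>}" "finite A" "b = {\<xi>. B \<subseteq> \<xi>}" "finite B" by auto
      then show "a \<inter> b \<in> ?E" by (intro CollectI exI[of _ "A \<union> B"]) auto
    qed
    show "range (\<lambda>_. UNIV) \<subseteq> ?E" by (auto intro!: exI[of _ "{}"])
    fix X assume "X \<in> ?E"
    then obtain F where F: "X = {\<xi>. F \<subseteq> \<xi>}" "finite F" by blast
    obtain xs where xs: "set xs = F" "distinct xs" using finite_distinct_list[OF F(2)] by blast
    have "complex_of_real (measure N X) =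
        Determinant.det (mat (length xs) (length xs) (\<lambda>(i, j). K (xs ! i) (xs ! j)))"
      if "determinantal_law N K" "space N = UNIV" for N
    proof -
      have "X = {\<xi> \<in> space N. set xs \<subseteq> \<xi>}" using that(2) F(1) xs(1) by simp
      with that(1) xs(2) show ?thesis unfolding determinantal_law_def by blast
    qed
    from this[OF assms(1) space(1)] this[OF assms(2) space(2)]
    have "measure \<mu> X = measure \<nu> X" by (metis of_real_eq_iff)
    then show "emeasure \<mu> X = emeasure \<nu> X"
      by (simp add: \<mu>.emeasure_eq_measure \<nu>.emeasure_eq_measure)
  qed (auto simp: sets sets_config_borel)
qed

text \<open>Occupation of a site is a clopen event, so the indicator of a correlation event, a
  finite product of occupation numbers, is itself a bounded continuous test function.\<close>

lemma weakly_converges_imp_correlations: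
  fixes \<mu> :: "nat \<Rightarrow> ('t \<Rightarrow> int set) measure"
  assumes J: "finite J"
    and sets: "\<And>n. sets (\<mu> n) = sets (PiM J (\<lambda>_. config_borel))" "sets \<nu> = sets (PiM J (\<lambda>_. config_borel))"
    and conv: "weakly_converges (product_topology (\<lambda>_. vague_topology) J) \<mu> \<nu>"
    and A: "finite A" "A \<subseteq> J \<times> UNIV"
  shows "(\<lambda>n. measure (\<mu> n) {\<omega> \<in> space (\<mu> n). \<forall>z\<in>A. snd z \<in> \<omega> (fst z)})
        \<longlonglongrightarrow> measure \<nu> {\<omega> \<in> space \<nu>. \<forall>z\<in>A. snd z \<in> \<omega> (fst z)}"
proof -
  let ?X = "product_topology (\<lambda>_. vague_topology) J"
  let ?f = "\<lambda>\<omega>. \<Prod>z\<in>A. indicat_real (\<omega> (fst z)) (snd z)"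
  have cont: "continuous_map ?X euclideanreal ?f"
  proof (rule continuous_map_prod[OF A(1)])
    fix z assume "z \<in> A"
    then have "continuous_map ?X vague_topology (\<lambda>\<omega>. \<omega> (fst z))"
      using A(2) by (intro continuous_map_product_projection) auto
    from continuous_map_compose[OF this continuous_map_vague_indicator[of "snd z"]]
    show "continuous_map ?X euclideanreal (\<lambda>\<omega>. indicat_real (\<omega> (fst z)) (snd z))"
      by (simp add: o_def)
  qed
  have f: "?f \<omega> = indicator {\<omega>. \<forall>z\<in>A. snd z \<in> \<omega> (fst z)} \<omega>" for \<omega>
    using A(1) by (auto simp: indicator_def of_bool_def intro!: prod.neutral)
  have "bounded (?f ` topspace ?X)"
    unfolding bounded_iff f by (intro exI[of _ 1]) (auto simp: indicator_def)
  with conv cont have "(\<lambda>n. \<integral>\<omega>. ?f \<omega> \<partial>\<mu> n) \<longlonglongrightarrow> (\<integral>\<omega>. ?f \<omega> \<partial>\<nu>)"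
    unfolding weakly_converges_def by blast
  moreover have "(\<integral>\<omega>. ?f \<omega> \<partial>N) = measure N {\<omega> \<in> space N. \<forall>z\<in>A. snd z \<in> \<omega> (fst z)}"
    if "sets N = sets (PiM J (\<lambda>_. config_borel))" for N
    unfolding f by (simp add: Int_def conj_commute)
  ultimately show ?thesis using sets by simp
qed

subsection \<open>Kolmogorov extension for binary events\<close>

text \<open>A sequence of families of events whose joint probabilities converge to \<open>q\<close>
  yields one family of random variables realizing \<open>q\<close>. Positivity and consistency are
  taken over from the approximating events and are never checked on \<open>q\<close> itself. The
  variables are real, with 1 marking occurrence, to fit \<open>polish_projective\<close>.\<close>

lemma (in prob_space) kolmogorov_extension_events:
  fixes E :: "nat \<Rightarrow> 'i \<Rightarrow> 'a set" and q :: "'i set \<Rightarrow> real"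
  assumes E: "\<And>n i. E n i \<in> sets M"
    and q: "\<And>A. finite A \<Longrightarrow> (\<lambda>n. measure M {\<omega> \<in> space M. \<forall>i\<in>A. \<omega> \<in> E n i}) \<longlonglongrightarrow> q A"
  shows "\<exists>R :: ('i \<Rightarrow> real) measure. prob_space R \<and> sets R = sets (PiM UNIV (\<lambda>_. borel)) \<and>
    (\<forall>A. finite A \<longrightarrow> measure R {\<omega> \<in> space R. \<forall>i\<in>A. \<omega> i = 1} = q A)"
proof -
  \<comment> \<open>\<open>g J T\<close> is the 0-1 pattern of \<open>T\<close> on \<open>J\<close>,
    \<open>W n J\<close> the random pattern at stage \<open>n\<close>, and \<open>L J\<close> its
    limiting law. Only the finitely many patterns \<open>g J T\<close> with
    \<open>T \<subseteq> J\<close> occur.\<close>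
  define g :: "'i set \<Rightarrow> 'i set \<Rightarrow> 'i \<Rightarrow> real" where "g J T = (\<lambda>i\<in>J. indicator T i)" for J T
  define W where "W n J \<omega> = g J {i. \<omega> \<in> E n i}" for n J \<omega>
  define L where "L J S = lim (\<lambda>n. measure M {\<omega> \<in> space M. W n J \<omega> \<in> S})" for J S
  define cell where "cell n J T = {\<omega> \<in> space M. (\<forall>i\<in>T. \<omega> \<in> E n i) \<and> (\<forall>i\<in>J - T. \<omega> \<notin> E n i)}" for n J T
  have pred: "Measurable.pred M (\<lambda>\<omega>. \<omega> \<in> E n i)" for n i
    using E[of n i] by (rule pred_sets2) simp
  have cell_sets: "cell n J T \<in> sets M" if "finite J" "T \<subseteq> J" for n J T
    unfolding cell_def using that pred
    by (intro sets.sets_Collect_conj sets.sets_Collect_finite_All sets.sets_Collect_neg)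
      (auto simp: pred_def intro: finite_subset)
  have g_eq_iff: "g J T = g J T' \<longleftrightarrow> T \<inter> J = T' \<inter> J" for J T T'
    by (auto simp: g_def fun_eq_iff restrict_def indicator_def split: if_splits)
  have W_split: "{\<omega> \<in> space M. W n J \<omega> \<in> S} = (\<Union>T\<in>{T \<in> Pow J. g J T \<in> S}. cell n J T)" for n J S
  proof (intro equalityI subsetI)
    fix \<omega> assume \<omega>: "\<omega> \<in> {\<omega> \<in> space M. W n J \<omega> \<in> S}"
    let ?T = "{i. \<omega> \<in> E n i} \<inter> J"
    have "g J ?T = g J {i. \<omega> \<in> E n i}" by (simp add: g_eq_iff)
    with \<omega> have "?T \<in> {T \<in> Pow J. g J T \<in> S}" "\<omega> \<in> cell n J ?T"
      by (auto simp: W_def cell_def)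
    then show "\<omega> \<in> (\<Union>T\<in>{T \<in> Pow J. g J T \<in> S}. cell n J T)" by (rule UN_I)
  next
    fix \<omega> assume "\<omega> \<in> (\<Union>T\<in>{T \<in> Pow J. g J T \<in> S}. cell n J T)"
    then obtain T where T: "T \<subseteq> J" "g J T \<in> S" "\<omega> \<in> cell n J T" by blast
    then have "{i. \<omega> \<in> E n i} \<inter> J = T \<inter> J" by (auto simp: cell_def)
    then have "W n J \<omega> = g J T" by (simp add: W_def g_eq_iff)
    with T show "\<omega> \<in> {\<omega> \<in> space M. W n J \<omega> \<in> S}" by (simp add: cell_def)
  qed
  have W_sets: "{\<omega> \<in> space M. W n J \<omega> \<in> S} \<in> sets M" if "finite J" for n J S
    unfolding W_split using that cell_sets by (intro sets.finite_UN) auto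
  have measure_W: "measure M {\<omega> \<in> space M. W n J \<omega> \<in> S} = (\<Sum>T\<in>{T \<in> Pow J. g J T \<in> S}. measure M (cell n J T))"
    if "finite J" for n J S
    unfolding W_split
  proof (rule finite_measure_finite_Union)
    show "disjoint_family_on (cell n J) {T \<in> Pow J. g J T \<in> S}"
      unfolding disjoint_family_on_def cell_def by blast
  qed (use that cell_sets in auto)
  have "convergent (\<lambda>n. measure M {\<omega> \<in> space M. W n J \<omega> \<in> S})" if J: "finite J" for J S
  proof -
    have "(\<lambda>n. measure M (cell n J T)) \<longlonglongrightarrow> (\<Sum>C\<in>Pow (J - T). (-1) ^ card C * q (T \<union> C))"
      if T: "T \<in> {T \<in> Pow J. g J T \<in> S}" for T
    proof -
      have fin: "finite T" "finite (J - T)" using J T by (auto intro: finite_subset)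
      have eq: "measure M (cell n J T) =
          (\<Sum>C\<in>Pow (J - T). (-1) ^ card C * measure M {\<omega> \<in> space M. \<forall>i\<in>T \<union> C. \<omega> \<in> E n i})" for n
        unfolding cell_def using fin pred by (intro measure_inclusion_exclusion[where I = UNIV]) auto
      show ?thesis unfolding eq
        by (intro tendsto_intros q) (use fin in \<open>auto intro: finite_subset\<close>)
    qed
    then have "(\<lambda>n. measure M {\<omega> \<in> space M. W n J \<omega> \<in> S}) \<longlonglongrightarrow>
        (\<Sum>T\<in>{T \<in> Pow J. g J T \<in> S}. \<Sum>C\<in>Pow (J - T). (-1) ^ card C * q (T \<union> C))"
      unfolding measure_W[OF J] by (rule tendsto_sum)
    then show ?thesis by (rule convergentI)
  qed
  then have L: "(\<lambda>n. measure M {\<omega> \<in> space M. W n J \<omega> \<in> S}) \<longlonglongrightarrow> L J S" if "finite J" for J S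
    using that by (simp add: L_def convergent_LIMSEQ_iff)
  have L_nonneg: "L J S \<ge> 0" if "finite J" for J S
    by (rule LIMSEQ_le_const[OF L[OF that]]) (simp add: measure_nonneg)
  \<comment> \<open>The patterns carrying the laws are finitely many and do not depend on
    \<open>n\<close>, so finite additivity passes to the limit and no mass escapes.\<close>
  have L_sum: "(\<Sum>h\<in>g J ` Pow J \<inter> S. L J {h}) = L J S" if J: "finite J" for J S
  proof (rule LIMSEQ_unique)
    show "(\<lambda>n. \<Sum>h\<in>g J ` Pow J \<inter> S. measure M {\<omega> \<in> space M. W n J \<omega> \<in> {h}}) \<longlonglongrightarrow> (\<Sum>h\<in>g J ` Pow J \<inter> S. L J {h})"
      by (intro tendsto_sum L J)
    have "(\<Sum>h\<in>g J ` Pow J \<inter> S. measure M {\<omega> \<in> space M. W n J \<omega> \<in> {h}}) = measure M {\<omega> \<in> space M. W n J \<omega> \<in> S}" for n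
    proof -
      have "W n J \<omega> = g J ({i. \<omega> \<in> E n i} \<inter> J)" for \<omega> by (simp add: W_def g_eq_iff)
      then have "W n J \<omega> \<in> g J ` Pow J" for \<omega> by simp
      then have "{\<omega> \<in> space M. W n J \<omega> \<in> S} = (\<Union>h\<in>g J ` Pow J \<inter> S. {\<omega> \<in> space M. W n J \<omega> \<in> {h}})"
        by auto
      also have "measure M \<dots> = (\<Sum>h\<in>g J ` Pow J \<inter> S. measure M {\<omega> \<in> space M. W n J \<omega> \<in> {h}})"
      proof (rule finite_measure_finite_Union)
        show "(\<lambda>h. {\<omega> \<in> space M. W n J \<omega> \<in> {h}}) ` (g J ` Pow J \<inter> S) \<subseteq> sets M"
          using W_sets[OF J] by (rule image_subsetI)
      qed (use J in \<open>auto simp: disjoint_family_on_def\<close>)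
      finally show ?thesis ..
    qed
    then show "(\<lambda>n. \<Sum>h\<in>g J ` Pow J \<inter> S. measure M {\<omega> \<in> space M. W n J \<omega> \<in> {h}}) \<longlonglongrightarrow> L J S"
      using L[OF J, of S] by simp
  qed
  have L_UNIV: "L J UNIV = 1" if "finite J" for J
    using L[OF that, of UNIV] by (simp add: prob_space LIMSEQ_const_iff)
  have L_outside: "L J {h} = 0" if "finite J" "h \<notin> g J ` Pow J" for J h
    using L_sum[OF that(1), of "{h}"] that(2) by simp
  define p where "p J = embed_pmf (\<lambda>h. L J {h})" for J
  have pmf_p: "pmf (p J) h = L J {h}" if J: "finite J" for J h
    unfolding p_def
  proof (rule pmf_embed_pmf)
    show "0 \<le> L J {h}" for h using L_nonneg[OF J] .
    have "(\<integral>\<^sup>+ h. ennreal (L J {h}) \<partial>count_space UNIV) = (\<Sum>h\<in>g J ` Pow J. ennreal (L J {h}))"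
      using J by (intro nn_integral_count_space') (auto simp: L_outside)
    also have "\<dots> = ennreal (\<Sum>h\<in>g J ` Pow J. L J {h})"
      by (intro sum_ennreal L_nonneg J)
    also have "(\<Sum>h\<in>g J ` Pow J. L J {h}) = 1"
      using L_sum[OF J, of UNIV] L_UNIV[OF J] by simp
    finally show "(\<integral>\<^sup>+ h. ennreal (L J {h}) \<partial>count_space UNIV) = 1" by simp
  qed
  have measure_p: "measure (p J) S = L J S" if J: "finite J" for J S
  proof -
    have "set_pmf (p J) \<subseteq> g J ` Pow J"
      using L_outside[OF J] unfolding set_pmf_iff pmf_p[OF J] subset_iff by blast
    then have "measure (p J) S = measure (p J) (g J ` Pow J \<inter> S)"
      by (intro measure_pmf.finite_measure_eq_AE) (auto simp: AE_measure_pmf_iff)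
    also have "\<dots> = L J S"
      using J by (simp add: measure_measure_pmf_finite pmf_p L_sum)
    finally show ?thesis .
  qed
  \<comment> \<open>Consistency: restricting a pattern on \<open>H\<close> to \<open>J\<close> gives
    the pattern on \<open>J\<close> already at each stage, hence also in the limit.\<close>
  have map_p: "p J = map_pmf (\<lambda>f. restrict f J) (p H)" if "J \<subseteq> H" "finite H" for J H
  proof (rule pmf_eqI)
    fix h
    have J: "finite J" using that by (rule finite_subset)
    have "restrict (W n H \<omega>) J = W n J \<omega>" for n \<omega>
      using that(1) by (auto simp: W_def g_def restrict_def fun_eq_iff)
    then have "L H ((\<lambda>f. restrict f J) -` {h}) = L J {h}"
      by (simp add: L_def)
    then show "pmf (p J) h = pmf (map_pmf (\<lambda>f. restrict f J) (p H)) h"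
      by (simp add: pmf_map measure_p[OF that(2)] pmf_p[OF J])
  qed
  \<comment> \<open>A pmf lives on the discrete space of all functions; pushing it forward by
    restriction places it on the product Borel field.\<close>
  define P :: "'i set \<Rightarrow> ('i \<Rightarrow> real) measure"
    where "P J = distr (p J) (PiM J (\<lambda>_. borel)) (\<lambda>f. restrict f J)" for J
  have meas: "(\<lambda>f. restrict f J) \<in> UNIV \<rightarrow> space (PiM J (\<lambda>_. borel :: real measure))" for J :: "'i set"
    by (auto simp: space_PiM)
  interpret polish_projective UNIV P
  proof (intro polish_projective.intro projective_family.intro)
    fix J H :: "'i set" assume JH: "J \<subseteq> H" "finite H" "H \<subseteq> UNIV"
    have "P J = distr (distr (p H) (count_space UNIV) (\<lambda>f. restrict f J)) (PiM J (\<lambda>_. borel)) (\<lambda>f. restrict f J)"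
      unfolding P_def map_p[OF JH(1,2)] map_pmf_rep_eq ..
    also have "\<dots> = distr (p H) (PiM J (\<lambda>_. borel)) (\<lambda>f. restrict f J)"
      using meas[of J] by (subst distr_distr) (auto simp: o_def measurable_def)
    also have "\<dots> = distr (P H) (PiM J (\<lambda>_. borel)) (\<lambda>f. restrict f J)"
      unfolding P_def using meas[of H] JH(1)
      by (subst distr_distr) (auto simp: o_def measurable_restrict_subset Int_absorb1)
    finally show "P J = distr (P H) (PiM J (\<lambda>_. borel)) (\<lambda>f. restrict f J)" .
  next
    fix J :: "'i set" show "prob_space (P J)"
      unfolding P_def using meas[of J] by (intro measure_pmf.prob_space_distr) simp
  qed
  show ?thesis
  proof (intro exI conjI allI impI)
    show "prob_space lim" by (rule P.prob_space_axioms)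
    show "sets lim = sets (PiM UNIV (\<lambda>_. borel))" by simp
    fix A :: "'i set" assume A: "finite A"
    define X where "X = PiE A (\<lambda>_. {1 :: real})"
    have X: "X \<in> sets (PiM A (\<lambda>_. borel))" unfolding X_def using A by (intro sets_PiM_I_finite) auto
    have X_iff: "restrict f A \<in> X \<longleftrightarrow> (\<forall>i\<in>A. f i = 1)" for f
      unfolding X_def PiE_iff by simp
    have "{\<omega> \<in> space lim. \<forall>i\<in>A. \<omega> i = 1} = emb UNIV A X"
      unfolding prod_emb_def set_eq_iff Int_iff vimage_eq X_iff by (auto simp: space_PiM)
    then have "measure lim {\<omega> \<in> space lim. \<forall>i\<in>A. \<omega> i = 1} = measure (P A) X"
      using measure_lim_emb[OF _ A X] by simp
    also have "\<dots> = measure (p A) {f. \<forall>i\<in>A. f i = 1}"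
      unfolding P_def using X meas[of A]
      by (subst measure_distr) (simp_all add: vimage_def X_iff)
    also have "\<dots> = L A {f. \<forall>i\<in>A. f i = 1}" by (rule measure_p[OF A])
    also have "\<dots> = q A"
    proof (rule LIMSEQ_unique[OF L[OF A]])
      have "W n A \<omega> \<in> {f. \<forall>i\<in>A. f i = 1} \<longleftrightarrow> (\<forall>i\<in>A. \<omega> \<in> E n i)" for n \<omega>
        by (auto simp: W_def g_def indicator_def)
      then show "(\<lambda>n. measure M {\<omega> \<in> space M. W n A \<omega> \<in> {f. \<forall>i\<in>A. f i = 1}}) \<longlonglongrightarrow> q A"
        using q[OF A] by simp
    qed
    finally show "measure lim {\<omega> \<in> space lim. \<forall>i\<in>A. \<omega> i = 1} = q A" .
  qed
qed

subsection \<open>Limit of the correlation kernel\<close>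

text \<open>\<open>k\<close> counts the steps to the right. The range and parity conditions in
  \<open>srw_p\<close> say that y - x = 2k - t is solvable with k <= t, so a sum over k replaces the
  case distinction.\<close>

lemma srw_p_eq_sum:
  "srw_p t y x = (\<Sum>k\<le>t. real (t choose k) / 2 ^ t * of_bool (y - x = 2 * int k - int t))"
proof (cases "\<bar>y - x\<bar> \<le> int t \<and> even (int t + (y - x))")
  case True
  define k0 where "k0 = nat ((int t + (y - x)) div 2)"
  have k0: "2 * int k0 = int t + (y - x)"
  proof -
    have "0 \<le> int t + (y - x)" using True by linarith
    then have "int k0 = (int t + (y - x)) div 2" by (simp add: k0_def pos_imp_zdiv_nonneg_iff)
    then show ?thesis using True by (simp only: even_two_times_div_two)
  qed
  have "(\<Sum>k\<le>t. real (t choose k) / 2 ^ t * of_bool (y - x = 2 * int k - int t)) =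
      (\<Sum>k\<le>t. if k = k0 then real (t choose k) / 2 ^ t else 0)"
    by (rule sum.cong) (use k0 in auto)
  also have "\<dots> = real (t choose k0) / 2 ^ t" using k0 True by (simp add: abs_le_iff)
  finally show ?thesis using True by (simp add: srw_p_def k0_def)
next
  case False
  have "of_bool (y - x = 2 * int k - int t) = (0::real)" if "k \<le> t" for k
  proof -
    have "\<not> y - x = 2 * int k - int t"
    proof
      assume eq: "y - x = 2 * int k - int t"
      then have "int t + (y - x) = 2 * int k" by simp
      then have "even (int t + (y - x))" by (simp only: dvd_triv_left)
      moreover have "\<bar>y - x\<bar> \<le> int t" unfolding eq using that by (simp add: abs_le_iff)
      ultimately show False using False by simp
    qed
    then show ?thesis by simp
  qed
  then show ?thesis using False by (auto simp: srw_p_def)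
qed

text \<open>The characteristic function of the walk after \<open>n\<close> steps, from the binomial
  theorem for (cis \<phi> + cis (- \<phi>)) / 2; the weights are those of
  \<open>srw_p_eq_sum\<close>.\<close>

lemma cos_power_eq_sum_cis:
  "complex_of_real (cos \<phi>) ^ n =
    (\<Sum>k\<le>n. complex_of_real (real (n choose k) / 2 ^ n) * cis (\<phi> * of_int (2 * int k - int n)))"
proof -
  have "complex_of_real (cos \<phi>) = (cis \<phi> + cis (- \<phi>)) / 2"
    by (simp add: complex_eq_iff)
  then have "complex_of_real (cos \<phi>) ^ n = (cis \<phi> + cis (- \<phi>)) ^ n / 2 ^ n"
    by (simp only: power_divide)
  also have "\<dots> = (\<Sum>k\<le>n. of_nat (n choose k) * cis \<phi> ^ k * cis (- \<phi>) ^ (n - k)) / 2 ^ n"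
    by (simp only: binomial_ring)
  also have "\<dots> = (\<Sum>k\<le>n. complex_of_real (real (n choose k) / 2 ^ n) * cis (\<phi> * of_int (2 * int k - int n)))"
    unfolding sum_divide_distrib
  proof (rule sum.cong[OF refl])
    fix k assume "k \<in> {..n}"
    then have "real k * \<phi> + real (n - k) * (- \<phi>) = \<phi> * of_int (2 * int k - int n)"
      by (simp add: of_nat_diff algebra_simps)
    then have "cis \<phi> ^ k * cis (- \<phi>) ^ (n - k) = cis (\<phi> * of_int (2 * int k - int n))"
      by (simp only: Complex.DeMoivre cis_mult)
    then show "of_nat (n choose k) * cis \<phi> ^ k * cis (- \<phi>) ^ (n - k) / 2 ^ n =
        complex_of_real (real (n choose k) / 2 ^ n) * cis (\<phi> * of_int (2 * int k - int n))"
      by (simp add: mult.assoc)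
  qed
  finally show ?thesis .
qed

text \<open>Orthogonality of the characters modulo \<open>a\<close>: the summands are the powers of
  an a-th root of unity \<open>z\<close>, and \<open>z ^ a = 1\<close> kills the geometric sum
  unless \<open>z = 1\<close>.\<close>

lemma sum_roots_of_unity:
  fixes v :: int
  assumes "a > 0"
  shows "(\<Sum>m<a. cis (2 * pi * real m * of_int v / real a)) = (if int a dvd v then of_nat a else 0)"
proof -
  define z where "z = cis (2 * pi * of_int v / real a)"
  have pow: "cis (2 * pi * real m * of_int v / real a) = z ^ m" for m
    by (simp add: z_def Complex.DeMoivre mult_ac)
  have za: "z ^ a = 1"
    using assms cis_multiple_2pi[of "of_int v"] by (simp add: z_def Complex.DeMoivre)
  have z1: "z = 1 \<longleftrightarrow> int a dvd v"
  proof
    assume "z = 1"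
    then obtain n :: int where "2 * pi * of_int v / real a = of_int n * (2 * pi)"
      by (auto simp: z_def cis_eq_1_iff)
    then have "real_of_int v = of_int (n * int a)" using assms by (simp add: field_simps)
    then show "int a dvd v" by (simp only: of_int_eq_iff) simp
  next
    assume "int a dvd v"
    then obtain n where "v = int a * n" by blast
    then have "2 * pi * of_int v / real a = 2 * pi * of_int n" using assms by simp
    then show "z = 1" unfolding z_def by (simp only: cis_multiple_2pi Ints_of_int)
  qed
  show ?thesis
  proof (cases "z = 1")
    case True
    then show ?thesis using z1 by (simp add: pow)
  next
    case False
    then show ?thesis using z1 za by (simp add: pow geometric_sum)
  qed
qed

text \<open>
  Poisson summation over the sublattice: the factors with \<open>m \<ge> 1\<close> come from the characters
  that detect divisibility by \<open>2a\<close> among the integers of the parity of \<open>s + x\<close>.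
\<close>

lemma sum_srw_p_cis:
  fixes x :: int and l :: real
  assumes a: "a > 0" and even: "even (int s + x)"
    and J: "finite J" "{j. \<bar>x - 2 * int a * j\<bar> \<le> int s} \<subseteq> J"
  shows "(\<Sum>j\<in>J. complex_of_real (srw_p s x (2 * int a * j)) * cis (- l * of_int j)) =
    (\<Sum>m<a. cis (- of_int x * (l / (2 * real a) - pi * real m / real a)) *
       complex_of_real (cos (l / (2 * real a) - pi * real m / real a)) ^ s) / of_nat a"
proof -
  define \<phi> where "\<phi> m = l / (2 * real a) - pi * real m / real a" for m :: nat
  \<comment> \<open>With \<open>k\<close> of its \<open>s\<close> steps to the right, the walk from
    2aj ends at x exactly when a j = \<open>v k\<close>. Evenness of s + x makes the division by 2
    exact.\<close>
  define v where "v k = (int s + x) div 2 - int k" for k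
  have v: "2 * v k = int s + x - 2 * int k" for k
    using even by (auto simp: v_def)
  define C where "C k = complex_of_real (real (s choose k) / 2 ^ s)" for k
  have "(\<Sum>j\<in>J. complex_of_real (srw_p s x (2 * int a * j)) * cis (- l * of_int j)) =
      (\<Sum>j\<in>J. \<Sum>k\<le>s. C k * (of_bool (int a * j = v k) * cis (- l * of_int j)))"
  proof (rule sum.cong[OF refl])
    fix j
    have "x - 2 * int a * j = 2 * int k - int s \<longleftrightarrow> int a * j = v k" for k
      using v[of k] by linarith
    then show "complex_of_real (srw_p s x (2 * int a * j)) * cis (- l * of_int j) =
        (\<Sum>k\<le>s. C k * (of_bool (int a * j = v k) * cis (- l * of_int j)))"
      unfolding srw_p_eq_sum C_def of_real_sum sum_distrib_right
      by (intro sum.cong) (simp_all add: mult_ac)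
  qed
  also have "\<dots> = (\<Sum>k\<le>s. C k * (\<Sum>j\<in>J. of_bool (int a * j = v k) * cis (- l * of_int j)))"
    by (subst sum.swap) (simp only: sum_distrib_left)
  also have "\<dots> = (\<Sum>k\<le>s. C k * (cis (- l * of_int (v k) / real a) * of_bool (int a dvd v k)))"
  proof (rule sum.cong[OF refl])
    fix k assume k: "k \<in> {..s}"
    have "(\<Sum>j\<in>J. of_bool (int a * j = v k) * cis (- l * of_int j)) =
        cis (- l * of_int (v k) / real a) * of_bool (int a dvd v k)"
    proof (cases "int a dvd v k")
      case True
      then obtain n where n: "v k = int a * n" by blast
      have "\<bar>x - 2 * int a * n\<bar> \<le> int s" using v[of k] k unfolding n by (simp add: abs_le_iff)
      then have "n \<in> J" using J by auto
      have "(\<Sum>j\<in>J. of_bool (int a * j = v k) * cis (- l * of_int j)) =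
          (\<Sum>j\<in>J. if j = n then cis (- l * of_int j) else 0)"
        using a n by (intro sum.cong) auto
      also have "\<dots> = cis (- l * of_int n)" using J \<open>n \<in> J\<close> by simp
      finally show ?thesis using n a by simp
    next
      case False
      then have "int a * j \<noteq> v k" for j by (metis dvd_triv_left)
      with False show ?thesis by simp
    qed
    then show "C k * (\<Sum>j\<in>J. of_bool (int a * j = v k) * cis (- l * of_int j)) =
        C k * (cis (- l * of_int (v k) / real a) * of_bool (int a dvd v k))" by simp
  qed
  also have "\<dots> = (\<Sum>k\<le>s. C k * (\<Sum>m<a. cis (- of_int x * \<phi> m) * cis (\<phi> m * of_int (2 * int k - int s)))) / of_nat a"
    unfolding sum_divide_distrib
  proof (rule sum.cong[OF refl])
    fix k
    have "cis (- of_int x * \<phi> m) * cis (\<phi> m * of_int (2 * int k - int s)) =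
        cis (- l * of_int (v k) / real a) * cis (2 * pi * real m * of_int (v k) / real a)" for m
    proof -
      \<comment> \<open>The phases combine to -2 \<open>v k\<close> times \<open>\<phi> m\<close>,
        which splits into a part free of \<open>m\<close> and the phase of the m-th character at
        \<open>v k\<close>.\<close>
      have "- of_int x * \<phi> m + \<phi> m * of_int (2 * int k - int s) = - \<phi> m * of_int (2 * v k)"
        unfolding v by (simp add: algebra_simps)
      also have "\<dots> = - l * of_int (v k) / real a + 2 * pi * real m * of_int (v k) / real a"
        using a by (simp add: \<phi>_def field_simps)
      finally show ?thesis by (simp only: cis_mult)
    qed
    then have "(\<Sum>m<a. cis (- of_int x * \<phi> m) * cis (\<phi> m * of_int (2 * int k - int s))) =
        cis (- l * of_int (v k) / real a) * (\<Sum>m<a. cis (2 * pi * real m * of_int (v k) / real a))"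
      by (simp add: sum_distrib_left)
    also have "\<dots> = cis (- l * of_int (v k) / real a) * (of_nat a * of_bool (int a dvd v k))"
      using sum_roots_of_unity[OF a, of "v k"] by simp
    finally show "C k * (cis (- l * of_int (v k) / real a) * of_bool (int a dvd v k)) =
        C k * (\<Sum>m<a. cis (- of_int x * \<phi> m) * cis (\<phi> m * of_int (2 * int k - int s))) / of_nat a"
      using a by simp
  qed
  also have "(\<Sum>k\<le>s. C k * (\<Sum>m<a. cis (- of_int x * \<phi> m) * cis (\<phi> m * of_int (2 * int k - int s)))) =
      (\<Sum>m<a. cis (- of_int x * \<phi> m) * complex_of_real (cos (\<phi> m)) ^ s)"
    unfolding cos_power_eq_sum_cis C_def sum_distrib_left
    by (subst sum.swap) (simp add: mult_ac)
  finally show ?thesis by (simp only: \<phi>_def)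
qed

text \<open>Since 2a >= 4 > 3, the angle is at most pi / 3 in absolute value. Using pi / 3 in place
  of pi / 4 gives a rational bound.\<close>

lemma cos_ge_half:
  assumes "a \<ge> 2" "\<bar>l\<bar> \<le> pi"
  shows "cos (l / (2 * real a)) \<ge> 1 / 2"
proof -
  have "\<bar>l / (2 * real a)\<bar> \<le> pi / 3"
  proof -
    have "\<bar>l\<bar> * 3 \<le> pi * (2 * real a)"
      using assms by (intro mult_mono) auto
    then show ?thesis using assms by (simp add: field_simps abs_mult)
  qed
  then have "cos (pi / 3) \<le> cos \<bar>l / (2 * real a)\<bar>"
    by (intro cos_monotone_0_pi_le) (auto simp: field_simps)
  then show ?thesis by (simp only: cos_60 cos_abs_real)
qed

text \<open>The contribution of the m-th character to the kernel, before normalization: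
  \<open>l\<close> is the integration variable of \<open>mart\<close>, and l / (2a) is the angle
  \<theta>.\<close>

definition ncrw_term :: "nat \<Rightarrow> nat \<Rightarrow> nat \<Rightarrow> int \<Rightarrow> nat \<Rightarrow> int \<Rightarrow> real \<Rightarrow> complex" where
  "ncrw_term a m s x t y l =
     cis (l * of_int y / (2 * real a) - of_int x * (l / (2 * real a) - pi * real m / real a)) *
     complex_of_real (cos (l / (2 * real a) - pi * real m / real a) ^ s / cos (l / (2 * real a)) ^ t)"

lemma ncrw_term_integrable:
  assumes "a \<ge> 2"
  shows "ncrw_term a m s x t y integrable_on {-pi..pi}"
proof (rule integrable_continuous_interval)
  have "cos (l / (2 * real a)) \<noteq> 0" if "l \<in> {-pi..pi}" for l
    using cos_ge_half[OF assms, of l] that by (auto simp: abs_le_iff)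
  then show "continuous_on {-pi..pi} (ncrw_term a m s x t y)"
    unfolding ncrw_term_def using assms by (intro continuous_intros) auto
qed

text \<open>Only finitely many lattice points reach \<open>x\<close> within \<open>s\<close> steps,
  so the sum over starting points is finite and passes under the integral of \<open>mart\<close>,
  where \<open>sum_srw_p_cis\<close> evaluates it. In the denominator, 2 pi comes from
  \<open>mart\<close> and \<open>a\<close> from averaging over the characters.\<close>

lemma ncrw_kernel_eq_sum_integral:
  assumes a: "a \<ge> 2" and even: "even (int s + x)" "even (int t + y)"
  shows "ncrw_kernel a s x t y =
    (\<Sum>m<a. integral {-pi..pi} (ncrw_term a m s x t y)) / (2 * pi * real a)
      - (if s > t then complex_of_real (srw_p (s - t) x y) else 0)"
proof -
  define J where "J = {j. \<bar>x - 2 * int a * j\<bar> \<le> int s}"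
  have "J \<subseteq> {- (int s + \<bar>x\<bar>)..int s + \<bar>x\<bar>}"
  proof
    fix j assume "j \<in> J"
    then have "\<bar>2 * int a * j\<bar> \<le> int s + \<bar>x\<bar>" by (simp add: J_def)
    moreover have "\<bar>j\<bar> \<le> \<bar>2 * int a * j\<bar>"
      using a mult_right_mono[of 1 "2 * int a" "\<bar>j\<bar>"] by (simp add: abs_mult)
    ultimately have "\<bar>j\<bar> \<le> int s + \<bar>x\<bar>" by linarith
    then show "j \<in> {- (int s + \<bar>x\<bar>)..int s + \<bar>x\<bar>}" unfolding atLeastAtMost_iff by (intro conjI; linarith)
  qed
  then have J: "finite J" by (rule finite_subset) simp
  define h where "h j l = cis (l * (of_int y / (2 * real a) - of_int j)) / complex_of_real (cos (l / (2 * real a)) ^ t)"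
    for j :: int and l :: real
  have cos0: "cos (l / (2 * real a)) \<noteq> 0" if "l \<in> {-pi..pi}" for l
    using cos_ge_half[OF a, of l] that by (auto simp: abs_le_iff)
  have h: "h j integrable_on {-pi..pi}" for j
    unfolding h_def using cos0 by (intro integrable_continuous_interval continuous_intros) (use a in auto)
  have mart: "mart a j t y = integral {-pi..pi} (h j) / (2 * pi)" for j
    unfolding mart_def h_def cis_conv_exp by simp
  have "(\<Sum>\<^sub>\<infinity>j\<in>UNIV. complex_of_real (srw_p s x (2 * int a * j)) * mart a j t y) =
      (\<Sum>\<^sub>\<infinity>j\<in>J. complex_of_real (srw_p s x (2 * int a * j)) * mart a j t y)"
    by (rule infsum_cong_neutral) (auto simp: J_def srw_p_def)
  also have "\<dots> = (\<Sum>j\<in>J. complex_of_real (srw_p s x (2 * int a * j)) * integral {-pi..pi} (h j)) / (2 * pi)"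
    using J by (simp add: mart sum_divide_distrib)
  also have "(\<Sum>j\<in>J. complex_of_real (srw_p s x (2 * int a * j)) * integral {-pi..pi} (h j)) =
      integral {-pi..pi} (\<lambda>l. \<Sum>j\<in>J. complex_of_real (srw_p s x (2 * int a * j)) * h j l)"
    using J h by (subst integral_sum) (auto intro: integrable_on_mult_right)
  also have "\<dots> = integral {-pi..pi} (\<lambda>l. (\<Sum>m<a. ncrw_term a m s x t y l) / of_nat a)"
  proof (rule integral_cong)
    fix l
    let ?e = "cis (l * of_int y / (2 * real a)) / complex_of_real (cos (l / (2 * real a)) ^ t)"
    have "h j l = ?e * cis (- l * of_int j)" for j
      by (simp add: h_def cis_mult algebra_simps)
    then have "(\<Sum>j\<in>J. complex_of_real (srw_p s x (2 * int a * j)) * h j l) =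
        ?e * (\<Sum>j\<in>J. complex_of_real (srw_p s x (2 * int a * j)) * cis (- l * of_int j))"
      unfolding sum_distrib_left by (simp only: mult.left_commute)
    also have "\<dots> = ?e * ((\<Sum>m<a. cis (- of_int x * (l / (2 * real a) - pi * real m / real a)) *
        complex_of_real (cos (l / (2 * real a) - pi * real m / real a)) ^ s) / of_nat a)"
      using a even(1) J by (subst sum_srw_p_cis) (auto simp: J_def)
    also have "\<dots> = (\<Sum>m<a. ncrw_term a m s x t y l) / of_nat a"
      unfolding times_divide_eq_right sum_distrib_left
    proof (intro arg_cong2[where f = "(/)"] sum.cong refl)
      fix m
      have "cis (l * of_int y / (2 * real a) - of_int x * (l / (2 * real a) - pi * real m / real a)) =
          cis (l * of_int y / (2 * real a)) * cis (- of_int x * (l / (2 * real a) - pi * real m / real a))"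
        by (simp add: cis_mult)
      then show "?e * (cis (- of_int x * (l / (2 * real a) - pi * real m / real a)) *
          complex_of_real (cos (l / (2 * real a) - pi * real m / real a)) ^ s) = ncrw_term a m s x t y l"
        by (simp add: ncrw_term_def)
    qed
    finally show "(\<Sum>j\<in>J. complex_of_real (srw_p s x (2 * int a * j)) * h j l) =
        (\<Sum>m<a. ncrw_term a m s x t y l) / of_nat a" .
  qed
  also have "\<dots> = (\<Sum>m<a. integral {-pi..pi} (ncrw_term a m s x t y)) / of_nat a"
    using ncrw_term_integrable[OF a] by (simp add: integral_sum)
  finally show ?thesis using even by (simp add: ncrw_kernel_def mult_ac)
qed

text \<open>With e = pi / (2a), \<theta> lies in (-e, e) and \<psi> = 2em - \<theta> lies in (e, pi
  - e), because 1 <= m <= a - 1. Hence |cos \<psi>| < cos e < cos \<theta>. For m = 1 and l = pi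
  there is equality, so the bound on \<open>l\<close> has to be strict.\<close>

lemma abs_cos_shift_less:
  fixes l :: real
  assumes "1 \<le> m" "m < a" "\<bar>l\<bar> < pi"
  shows "\<bar>cos (l / (2 * real a) - pi * real m / real a)\<bar> < cos (l / (2 * real a))"
proof -
  define e where "e = pi / (2 * real a)"
  define \<theta> where "\<theta> = l / (2 * real a)"
  define \<psi> where "\<psi> = pi * real m / real a - \<theta>"
  have a: "real a > 0" using assms by simp
  have \<theta>: "\<bar>\<theta>\<bar> < e" using assms a by (simp add: \<theta>_def e_def abs_mult divide_strict_right_mono)
  have e: "0 < e" "e < pi" using a assms by (auto simp: e_def field_simps)
  have "2 * e * 1 \<le> 2 * e * real m" using assms e by (intro mult_left_mono) auto
  then have lo: "e < \<psi>" using \<theta> a by (simp add: \<psi>_def e_def)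
  have "2 * e * real m \<le> 2 * e * (real a - 1)" using assms e by (intro mult_left_mono) auto
  also have "\<dots> = pi - 2 * e" using a by (simp add: e_def field_simps)
  finally have hi: "\<psi> < pi - e" using \<theta> a by (simp add: \<psi>_def e_def)
  have "cos \<psi> < cos e" by (rule cos_monotone_0_pi) (use lo hi e in auto)
  moreover have "cos (pi - e) < cos \<psi>" by (rule cos_monotone_0_pi) (use lo hi e in auto)
  moreover have "cos e < cos \<theta>"
    using cos_monotone_0_pi[of "\<bar>\<theta>\<bar>" e] \<theta> e by (simp only: cos_abs_real)
  moreover have "cos (l / (2 * real a) - pi * real m / real a) = cos \<psi>"
    using cos_minus[of \<psi>] by (simp add: \<psi>_def \<theta>_def)
  ultimately show ?thesis by (simp add: \<theta>_def abs_less_iff)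
qed

text \<open>Write S, T for the shifted times, c for cos (l / (2a)) and r < 1 for the ratio of the
  two cosines in absolute value. The integrand has norm r^S times c^S / c^T, and c lies in [1/2, 1],
  so \<open>2 ^ D\<close> dominates: T <= S + D holds even after truncation by \<open>nat\<close>.
  The open interval avoids the endpoints, where r may be 1.\<close>

lemma integral_ncrw_term_tendsto_0:
  fixes s t :: int
  assumes a: "a \<ge> 2" and m: "1 \<le> m" "m < a"
  shows "(\<lambda>n. integral {-pi..pi} (ncrw_term a m (nat (2 * int n + s)) x (nat (2 * int n + t)) y)) \<longlonglongrightarrow> 0"
proof -
  let ?f = "\<lambda>n. ncrw_term a m (nat (2 * int n + s)) x (nat (2 * int n + t)) y"
  define D where "D = nat (t - s)"
  have bound: "norm (?f n l) \<le> r ^ nat (2 * int n + s) * 2 ^ D"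
    if l: "l \<in> {-pi<..<pi}" and r: "r = \<bar>cos (l / (2 * real a) - pi * real m / real a)\<bar> / cos (l / (2 * real a))"
    for n l r
  proof -
    define c where "c = cos (l / (2 * real a))"
    define S T where "S = nat (2 * int n + s)" and "T = nat (2 * int n + t)"
    have c: "1 / 2 \<le> c" "c \<le> 1" using cos_ge_half[OF a, of l] l by (auto simp: c_def)
    have "c ^ (S + D) \<le> c ^ T" using c by (intro power_decreasing) (auto simp: S_def T_def D_def)
    then have "c ^ S / c ^ T \<le> c ^ S / c ^ (S + D)" using c by (intro divide_left_mono) auto
    also have "\<dots> = (1 / c) ^ D" using c by (simp add: power_add power_one_over)
    also have "\<dots> \<le> 2 ^ D" using c by (intro power_mono) (auto simp: field_simps)
    finally have *: "c ^ S / c ^ T \<le> 2 ^ D" .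
    have "norm (?f n l) = \<bar>cos (l / (2 * real a) - pi * real m / real a)\<bar> ^ S / c ^ T"
      using c by (simp add: ncrw_term_def norm_mult norm_divide norm_power power_abs S_def T_def c_def)
    also have "\<dots> = r ^ S * (c ^ S / c ^ T)" using c r by (simp add: power_divide c_def)
    also have "\<dots> \<le> r ^ S * 2 ^ D" using * c r by (intro mult_left_mono) (auto simp: c_def)
    finally show ?thesis by (simp add: S_def)
  qed
  have r: "0 \<le> \<bar>cos (l / (2 * real a) - pi * real m / real a)\<bar> / cos (l / (2 * real a))"
    "\<bar>cos (l / (2 * real a) - pi * real m / real a)\<bar> / cos (l / (2 * real a)) < 1" if "l \<in> {-pi<..<pi}" for l
    using abs_cos_shift_less[OF m, of l] cos_ge_half[OF a, of l] that by (auto simp: abs_less_iff)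
  have "(\<lambda>n. integral {-pi<..<pi} (?f n)) \<longlonglongrightarrow> integral {-pi<..<pi} (\<lambda>_. 0 :: complex)"
  proof (rule dominated_convergence(2))
    show "?f n integrable_on {-pi<..<pi}" for n
      using ncrw_term_integrable[OF a] by (simp add: integrable_on_open_interval_real)
    show "(\<lambda>_. 2 ^ D :: real) integrable_on {-pi<..<pi}"
      by (simp add: integrable_on_open_interval_real integrable_const_ivl)
    fix l assume l: "l \<in> {-pi<..<pi}"
    let ?r = "\<bar>cos (l / (2 * real a) - pi * real m / real a)\<bar> / cos (l / (2 * real a))"
    show "norm (?f n l) \<le> 2 ^ D" for n
    proof -
      have "?r ^ nat (2 * int n + s) \<le> 1" using r[OF l] by (intro power_le_one) auto
      then have "?r ^ nat (2 * int n + s) * 2 ^ D \<le> 1 * 2 ^ D" by (intro mult_right_mono) auto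
      with bound[OF l refl, of n] show ?thesis by linarith
    qed
    have "filterlim (\<lambda>n. nat (2 * int n + s)) at_top sequentially"
      unfolding filterlim_at_top
    proof
      fix Z :: nat
      show "\<forall>\<^sub>F n in sequentially. Z \<le> nat (2 * int n + s)"
        using eventually_ge_at_top[of "Z + nat \<bar>s\<bar>"] by eventually_elim auto
    qed
    moreover have "(\<lambda>k. ?r ^ k) \<longlonglongrightarrow> 0" using r[OF l] by (intro LIMSEQ_power_zero) auto
    ultimately have "(\<lambda>n. ?r ^ nat (2 * int n + s)) \<longlonglongrightarrow> 0" by (rule filterlim_compose[rotated])
    then have lim: "(\<lambda>n. ?r ^ nat (2 * int n + s) * 2 ^ D) \<longlonglongrightarrow> 0" by (rule tendsto_mult_left_zero)
    show "(\<lambda>n. ?f n l) \<longlonglongrightarrow> 0"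
      by (rule Lim_null_comparison[OF always_eventually[OF allI] lim]) (rule bound[OF l refl])
  qed
  then show ?thesis by (simp add: integral_open_interval_real)
qed

section \<open>Fourier integrals: the term m = 0 and the subtracted transition probability\<close>

lemma integral_cis_even:
  fixes f :: "real \<Rightarrow> real"
  assumes c: "c \<ge> 0" and f: "continuous_on {-c..c} f" "\<And>u. f (- u) = f u"
  shows "integral {-c..c} (\<lambda>u. cis (pi * u * z) * complex_of_real (f u)) =
    complex_of_real (integral {0..c} (\<lambda>u. 2 * cos (pi * u * z) * f u))"
proof -
  define h where "h u = cis (pi * u * z) * complex_of_real (f u)" for u
  have cont: "continuous_on {-c..c} h"
    unfolding h_def by (intro continuous_intros f)
  then have int: "h integrable_on {-c..c}" by (rule integrable_continuous_interval)
  have pos: "h integrable_on {0..c}"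
    by (rule integrable_continuous_interval, rule continuous_on_subset[OF cont]) (use c in auto)
  have "continuous_on {0..c} (\<lambda>u. h (- u))"
    by (rule continuous_on_compose2[OF cont]) (use c in \<open>auto intro!: continuous_intros\<close>)
  then have neg: "(\<lambda>u. h (- u)) integrable_on {0..c}" by (rule integrable_continuous_interval)
  have "integral {-c..c} h = integral {-c..0} h + integral {0..c} h"
    using int c by (intro Henstock_Kurzweil_Integration.integral_combine[symmetric]) auto
  also have "integral {-c..0} h = integral {0..c} (\<lambda>u. h (- u))"
    using Henstock_Kurzweil_Integration.integral_reflect_real[of c 0 "\<lambda>u. h (- u)"] by simp
  also have "\<dots> + integral {0..c} h = integral {0..c} (\<lambda>u. h (- u) + h u)"
    using neg pos by (simp add: integral_add)
  also have "(\<lambda>u. h (- u) + h u) = (\<lambda>u. complex_of_real (2 * cos (pi * u * z) * f u))"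
    by (auto simp: h_def f(2) complex_eq_iff fun_eq_iff algebra_simps)
  also have "integral {0..c} \<dots> = complex_of_real (integral {0..c} (\<lambda>u. 2 * cos (pi * u * z) * f u))"
  proof -
    have "continuous_on {0..c} (\<lambda>u. 2 * cos (pi * u * z) * f u)"
      by (intro continuous_intros continuous_on_subset[OF f(1)]) (use c in auto)
    from integral_linear[OF integrable_continuous_interval[OF this] bounded_linear_of_real]
    show ?thesis by (simp add: o_def)
  qed
  finally show ?thesis by (simp add: h_def)
qed

lemma integral_cos_pi:
  fixes c z :: real
  assumes "c \<ge> 0"
  shows "integral {0..c} (\<lambda>u. 2 * cos (pi * u * z)) =
    (if z = 0 then 2 * c else 2 * sin (pi * c * z) / (pi * z))"
proof (cases "z = 0")
  case True
  then show ?thesis using assms by simp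
next
  case False
  have "((\<lambda>u. 2 * sin (pi * u * z) / (pi * z)) has_real_derivative 2 * cos (pi * u * z)) (at u within {0..c})" for u
    using False by (auto intro!: derivative_eq_intros simp: field_simps)
  then have int: "((\<lambda>u. 2 * cos (pi * u * z)) has_integral
      (2 * sin (pi * c * z) / (pi * z) - 2 * sin (pi * 0 * z) / (pi * z))) {0..c}"
    using assms by (intro fundamental_theorem_of_calculus)
      (auto simp: has_real_derivative_iff_has_vector_derivative)
  have "2 * sin (pi * c * z) / (pi * z) - 2 * sin (pi * 0 * z) / (pi * z) = 2 * sin (pi * c * z) / (pi * z)"
    by simp
  with integral_unique[OF int] False show ?thesis by (simp only: if_False)
qed

text \<open>Fourier inversion for the walk from y to x. By parity every frequency of the product is
  an even integer 2 \<open>v k\<close>, so the interval [-1/2, 1/2] consists of whole periods and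
  annihilates all of them except \<open>v k = 0\<close>, which selects the required number of steps
  to the right.\<close>

lemma integral_cos_power_eq_srw_p:
  fixes x y :: int
  assumes "even (int r + (y - x))"
  shows "integral {0..1/2} (\<lambda>u. 2 * cos (pi * u * of_int (y - x)) * cos (pi * u) ^ r) = srw_p r x y"
proof -
  define v where "v k = (y - x + 2 * int k - int r) div 2" for k
  have v: "2 * v k = y - x + 2 * int k - int r" for k
    using assms by (auto simp: v_def)
  define C where "C k = real (r choose k) / 2 ^ r" for k
  have basic: "integral {-(1/2)..1/2} (\<lambda>u. cis (pi * u * of_int (2 * v k))) =
      complex_of_real (of_bool (x - y = 2 * int k - int r))" for k
  proof -
    have "integral {-(1/2)..1/2} (\<lambda>u. cis (pi * u * of_int (2 * v k))) =
        complex_of_real (integral {0..1/2} (\<lambda>u. 2 * cos (pi * u * of_int (2 * v k))))"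
      using integral_cis_even[of "1/2" "\<lambda>_. 1" "of_int (2 * v k)"] by simp
    also have "integral {0..1/2} (\<lambda>u. 2 * cos (pi * u * of_int (2 * v k))) = of_bool (v k = 0)"
    proof (cases "v k = 0")
      case False
      have "pi * (1 / 2) * of_int (2 * v k) = of_int (v k) * pi" by simp
      then have "sin (pi * (1 / 2) * of_int (2 * v k)) = 0"
        by (simp only: sin_times_pi_eq_0 Ints_of_int)
      then show ?thesis
        using False by (subst integral_cos_pi) (simp_all only: mult_zero_right div_0, simp_all)
    qed simp
    also have "v k = 0 \<longleftrightarrow> x - y = 2 * int k - int r" using v[of k] by linarith
    finally show ?thesis .
  qed
  have "complex_of_real (integral {0..1/2} (\<lambda>u. 2 * cos (pi * u * of_int (y - x)) * cos (pi * u) ^ r)) =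
      integral {-(1/2)..1/2} (\<lambda>u. cis (pi * u * of_int (y - x)) * complex_of_real (cos (pi * u) ^ r))"
    by (rule integral_cis_even[symmetric]) (auto intro!: continuous_intros)
  also have "\<dots> = integral {-(1/2)..1/2} (\<lambda>u. \<Sum>k\<le>r. complex_of_real (C k) * cis (pi * u * of_int (2 * v k)))"
  proof (rule integral_cong)
    fix u :: real
    have e: "cis (pi * u * of_int (y - x)) * cis (pi * u * of_int (2 * int k - int r)) = cis (pi * u * of_int (2 * v k))" for k
      unfolding v cis_mult by (simp add: algebra_simps)
    show "cis (pi * u * of_int (y - x)) * complex_of_real (cos (pi * u) ^ r) =
        (\<Sum>k\<le>r. complex_of_real (C k) * cis (pi * u * of_int (2 * v k)))"
      unfolding of_real_power cos_power_eq_sum_cis C_def sum_distrib_left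
      by (intro sum.cong refl) (subst mult.left_commute, simp only: e)
  qed
  also have "\<dots> = (\<Sum>k\<le>r. complex_of_real (C k) * integral {-(1/2)..1/2} (\<lambda>u. cis (pi * u * of_int (2 * v k))))"
    by (subst integral_sum) (auto intro!: integrable_continuous_interval continuous_intros)
  also have "\<dots> = complex_of_real (srw_p r x y)"
    by (simp only: basic srw_p_eq_sum C_def of_real_sum of_real_mult)
  finally show ?thesis by (simp only: of_real_eq_iff)
qed

text \<open>True also for \<open>c = 0\<close> under the conventions for division by zero. Thus
  integrands with a negative exponent become products with a power of the cosine, continuous up to u
  = 1/2.\<close>

lemma divide_powi_neg:
  fixes w c :: "'a :: field"
  shows "w / (c powi (- int r)) = w * c ^ r"
  by (simp add: power_int_minus divide_inverse)

text \<open>Substitution u = l / (2 pi a), so that pi u = l / (2a): \<open>M\<close> is the scale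
  factor, its inverse the Jacobian, and [-pi, pi] becomes [-\<rho>, \<rho>]. For m = 0 no shift of
  the angle remains, so the phases of x and y merge and the two cosines form one power; evenness
  then folds the interval.\<close>

lemma integral_ncrw_term_0:
  fixes S T :: nat
  assumes a: "a \<ge> 2"
  shows "integral {-pi..pi} (ncrw_term a 0 S x T y) = 2 * pi * real a *
    complex_of_real (integral {0..1 / (2 * real a)}
      (\<lambda>u. 2 * cos (pi * u * of_int (y - x)) / cos (pi * u) powi (int T - int S)))"
proof -
  define f where "f u = 1 / cos (pi * u) powi (int T - int S)" for u
  define g where "g u = cis (pi * u * of_int (y - x)) * complex_of_real (f u)" for u
  define M where "M = 1 / (2 * pi * real a)"
  define \<rho> where "\<rho> = 1 / (2 * real a)"
  have pos: "cos (pi * u) > 0" if "u \<in> {-\<rho>..\<rho>}" for u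
  proof -
    have "2 * real a * pi * \<bar>u\<bar> \<le> 2 * real a * pi * \<rho>"
      using that by (intro mult_left_mono) auto
    then have "\<bar>2 * real a * pi * u\<bar> \<le> pi" using a by (simp add: \<rho>_def abs_mult)
    from cos_ge_half[OF a this] show ?thesis using a by (simp add: field_simps)
  qed
  have "ncrw_term a 0 S x T y l = g (M * l)" if "l \<in> {-pi..pi}" for l
  proof -
    have c: "cos (l / (2 * real a)) \<noteq> 0" using cos_ge_half[OF a, of l] that by (auto simp: abs_le_iff)
    have eq: "pi * (M * l) = l / (2 * real a)" using a by (simp add: M_def field_simps)
    have "l * of_int y / (2 * real a) - of_int x * (l / (2 * real a)) = l / (2 * real a) * of_int (y - x)"
      using a by (simp add: field_simps)
    then show ?thesis
      using c by (simp add: ncrw_term_def g_def f_def eq power_int_diff)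
  qed
  then have "integral {-pi..pi} (ncrw_term a 0 S x T y) = integral {-pi..pi} (\<lambda>l. g (M * l))"
    by (rule integral_cong)
  also have "\<dots> = integral ((\<lambda>l. l / M) ` {-\<rho>..\<rho>}) (\<lambda>l. g (M * l))"
    using a by (subst image_divide_atLeastAtMost) (simp_all add: M_def \<rho>_def)
  also have "\<dots> = (1 / \<bar>M\<bar>) *\<^sub>R integral {-\<rho>..\<rho>} g"
    by (rule integral_stretch_real) (use a in \<open>simp add: M_def\<close>)
  also have "integral {-\<rho>..\<rho>} g = complex_of_real (integral {0..\<rho>} (\<lambda>u. 2 * cos (pi * u * of_int (y - x)) * f u))"
    unfolding g_def
  proof (rule integral_cis_even)
    show "continuous_on {-\<rho>..\<rho>} f"
      unfolding f_def by (intro continuous_intros continuous_on_power_int) (use pos in force)+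
  qed (simp_all add: f_def \<rho>_def)
  finally show ?thesis using a by (simp add: f_def M_def \<rho>_def scaleR_conv_of_real)
qed

text \<open>One formula for the three cases. For S > T the transition probability is the same
  integrand over [0, 1/2], so subtracting it from the integral over [0, \<rho>] leaves minus the
  integral over [\<rho>, 1/2].\<close>

lemma eq_fun_eq:
  fixes x y :: int and S T :: nat
  assumes a: "a \<ge> 2" and \<rho>: "\<rho> = 1 / (2 * real a)" and even: "even (int S + x)" "even (int T + y)"
  shows "eq_fun \<rho> (int T - int S) (y - x) =
    integral {0..\<rho>} (\<lambda>u. 2 * cos (pi * u * of_int (y - x)) / cos (pi * u) powi (int T - int S))
      - (if S > T then srw_p (S - T) x y else 0)"
proof -
  let ?F = "\<lambda>u. 2 * cos (pi * u * of_int (y - x)) / cos (pi * u) powi (int T - int S)"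
  have \<rho>0: "0 \<le> \<rho>" "\<rho> \<le> 1/2" using a by (simp_all add: \<rho>)
  consider "S < T" | "S = T" | "S > T" by linarith
  then show ?thesis
  proof cases
    case 1
    then show ?thesis by (simp add: eq_fun_def)
  next
    case 2
    then show ?thesis
      using integral_cos_pi[OF \<rho>0(1), of "of_int (y - x)"] by (simp add: eq_fun_def sine_fun_def)
  next
    case 3
    define r where "r = S - T"
    have r: "int T - int S = - int r" using 3 by (simp add: r_def)
    have F: "?F = (\<lambda>u. 2 * cos (pi * u * of_int (y - x)) * cos (pi * u) ^ r)"
      unfolding r divide_powi_neg ..
    have "even (int r + (y - x))"
    proof -
      have "int r + (y - x) = (int S + x) + (int T + y) - 2 * (int T + x)" using 3 by (simp add: r_def)
      with even show ?thesis by presburger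
    qed
    then have "integral {0..1/2} ?F = srw_p r x y"
      unfolding F by (rule integral_cos_power_eq_srw_p)
    moreover have "integral {0..\<rho>} ?F + integral {\<rho>..1/2} ?F = integral {0..1/2} ?F"
      unfolding F using \<rho>0
      by (intro Henstock_Kurzweil_Integration.integral_combine integrable_continuous_interval continuous_intros)
    ultimately have "- integral {\<rho>..1/2} ?F = integral {0..\<rho>} ?F - srw_p r x y" by linarith
    then show ?thesis using 3 by (simp add: eq_fun_def r_def)
  qed
qed

lemma ncrw_kernel_tendsto_eq_kernel:
  fixes s t x y :: int
  assumes a: "a \<ge> 2" and \<rho>: "\<rho> = 1 / (2 * real a)"
  shows "(\<lambda>n. ncrw_kernel a (nat (2 * int n + s)) x (nat (2 * int n + t)) y) \<longlonglongrightarrow> eq_kernel \<rho> s x t y"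
proof (cases "even (s + x) \<and> even (t + y)")
  case True
  define G where "G = integral {0..\<rho>} (\<lambda>u. 2 * cos (pi * u * of_int (y - x)) / cos (pi * u) powi (t - s))"
  define p where "p = (if s > t then srw_p (nat (s - t)) x y else 0)"
  let ?I = "\<lambda>n m. integral {-pi..pi} (ncrw_term a m (nat (2 * int n + s)) x (nat (2 * int n + t)) y)"
  have ev: "\<forall>\<^sub>F n in sequentially. 2 * int n + s \<ge> 0 \<and> 2 * int n + t \<ge> 0"
    using eventually_ge_at_top[of "nat \<bar>s\<bar> + nat \<bar>t\<bar>"] by eventually_elim auto
  have "(\<lambda>n. (\<Sum>m<a. ?I n m) / (2 * pi * real a) - complex_of_real p) \<longlonglongrightarrow>
      (\<Sum>m<a. if m = 0 then 2 * pi * real a * complex_of_real G else 0) / (2 * pi * real a) - complex_of_real p"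
  proof (intro tendsto_intros)
    fix m assume m: "m \<in> {..<a}"
    show "(\<lambda>n. ?I n m) \<longlonglongrightarrow> (if m = 0 then 2 * pi * real a * complex_of_real G else 0)"
    proof (cases "m = 0")
      case True
      have "\<forall>\<^sub>F n in sequentially. ?I n 0 = 2 * pi * real a * complex_of_real G"
        using ev
      proof eventually_elim
        case (elim n)
        then have "int (nat (2 * int n + t)) - int (nat (2 * int n + s)) = t - s" by simp
        then show ?case unfolding G_def \<rho> integral_ncrw_term_0[OF a] by (simp only:)
      qed
      then show ?thesis unfolding True by (simp add: tendsto_eventually)
    next
      case False
      then show ?thesis using integral_ncrw_term_tendsto_0[OF a, of m] m by simp
    qed
  qed (use a in auto)
  moreover have "(\<Sum>m<a. if m = 0 then 2 * pi * real a * complex_of_real G else 0) / (2 * pi * real a) - complex_of_real p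
      = complex_of_real (G - p)"
    using a by simp
  moreover have "\<forall>\<^sub>F n in sequentially. (\<Sum>m<a. ?I n m) / (2 * pi * real a) - complex_of_real p =
      ncrw_kernel a (nat (2 * int n + s)) x (nat (2 * int n + t)) y"
    using ev
  proof eventually_elim
    case (elim n)
    have "nat (2 * int n + t) < nat (2 * int n + s) \<longleftrightarrow> s > t"
      "nat (2 * int n + s) - nat (2 * int n + t) = nat (s - t)" using elim by auto
    moreover have "even (int (nat (2 * int n + s)) + x)" "even (int (nat (2 * int n + t)) + y)"
      using elim True by simp_all
    ultimately show ?case
      by (subst ncrw_kernel_eq_sum_integral[OF a]) (simp_all add: p_def)
  qed
  moreover have "eq_fun \<rho> (t - s) (y - x) = G - p"
  proof -
    \<comment> \<open>\<open>eq_fun_eq\<close> speaks of natural times. The even shift 2N makes both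
      times nonnegative without changing their difference or their parities.\<close>
    define N where "N = \<bar>s\<bar> + \<bar>t\<bar>"
    have N: "2 * N + s \<ge> 0" "2 * N + t \<ge> 0" by (auto simp: N_def)
    then have "int (nat (2 * N + t)) - int (nat (2 * N + s)) = t - s"
      "nat (2 * N + t) < nat (2 * N + s) \<longleftrightarrow> s > t"
      "nat (2 * N + s) - nat (2 * N + t) = nat (s - t)" by auto
    with eq_fun_eq[OF a \<rho>, of "nat (2 * N + s)" x "nat (2 * N + t)" y] True N
    show ?thesis by (simp add: G_def p_def)
  qed
  ultimately show ?thesis
    using True by (simp add: eq_kernel_def Lim_transform_eventually)
next
  case False
  have "\<forall>\<^sub>F n in sequentially. ncrw_kernel a (nat (2 * int n + s)) x (nat (2 * int n + t)) y = 0"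
    using eventually_ge_at_top[of "nat \<bar>s\<bar> + nat \<bar>t\<bar>"]
  proof eventually_elim
    case (elim n)
    then have "2 * int n + s \<ge> 0" "2 * int n + t \<ge> 0" by auto
    then show ?case using False by (auto simp: ncrw_kernel_def)
  qed
  moreover have "eq_kernel \<rho> s x t y = 0" using False by (auto simp: eq_kernel_def)
  ultimately show ?thesis by (simp only: tendsto_eventually)
qed

subsection \<open>The equilibrium process\<close>

text \<open>By the Leibniz formula, the determinant is a polynomial in the entries.\<close>

lemma tendsto_det:
  fixes f :: "'b \<Rightarrow> nat \<Rightarrow> nat \<Rightarrow> complex"
  assumes "\<And>i j. i < k \<Longrightarrow> j < k \<Longrightarrow> ((\<lambda>n. f n i j) \<longlongrightarrow> g i j) F"
  shows "((\<lambda>n. Determinant.det (mat k k (\<lambda>(i, j). f n i j))) \<longlongrightarrow> Determinant.det (mat k k (\<lambda>(i, j). g i j))) F"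
proof -
  have det: "Determinant.det (mat k k (\<lambda>(i, j). h i j)) =
      (\<Sum>p | p permutes {0..<k}. signof p * (\<Prod>i = 0..<k. h i (p i)))" for h :: "nat \<Rightarrow> nat \<Rightarrow> complex"
  proof -
    have "p i < k" if "p permutes {0..<k}" "i \<in> {0..<k}" for p i
      using permutes_in_image[OF that(1), of i] that(2) by simp
    then show ?thesis by (subst det_def') (auto intro!: sum.cong prod.cong)
  qed
  show ?thesis
    unfolding det
  proof (intro tendsto_sum tendsto_mult tendsto_const tendsto_prod)
    fix p i assume "p \<in> {p. p permutes {0..<k}}" "i \<in> {0..<k}"
    then show "((\<lambda>n. f n i (p i)) \<longlongrightarrow> g i (p i)) F"
      using permutes_in_image[of p "{0..<k}" i] by (intro assms) auto
  qed
qed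

text \<open>Reversing both rows and columns applies one permutation twice, so its sign appears
  squared. Reversal and transposition occur together under time reversal: the points must be put
  back in order, and the kernel exchanges its arguments.\<close>

lemma det_reverse_transpose:
  fixes f :: "nat \<Rightarrow> nat \<Rightarrow> 'a :: comm_ring_1"
  shows "Determinant.det (mat k k (\<lambda>(i, j). f (k - 1 - j) (k - 1 - i))) = Determinant.det (mat k k (\<lambda>(i, j). f i j))"
proof -
  define p where "p i = (if i < k then k - 1 - i else i)" for i
  have p: "p permutes {0..<k}"
  proof (rule bij_imp_permutes)
    show "bij_betw p {0..<k} {0..<k}"
      by (rule bij_betw_byWitness[where f' = p]) (auto simp: p_def)
  qed (simp add: p_def)
  define A where "A = mat k k (\<lambda>(i, j). f i j)"
  define B where "B = transpose_mat (mat k k (\<lambda>(i, j). A $$ (p i, j)))"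
  have A: "A \<in> carrier_mat k k" and B: "B \<in> carrier_mat k k" by (simp_all add: A_def B_def)
  have "mat k k (\<lambda>(i, j). f (k - 1 - j) (k - 1 - i)) = mat k k (\<lambda>(i, j). B $$ (p i, j))"
    by (rule eq_matI) (auto simp: A_def B_def p_def)
  also have "Determinant.det \<dots> = signof p * Determinant.det B" by (rule det_permute_rows[OF B p])
  also have "Determinant.det B = signof p * Determinant.det A"
    unfolding B_def by (subst det_transpose[of _ k]) (simp_all add: det_permute_rows[OF A p])
  also have "signof p * (signof p * Determinant.det A) = Determinant.det A"
    by (simp add: sign_def)
  finally show ?thesis by (simp add: A_def)
qed

section \<open>Correlations of the shifted processes\<close>

lemma determinantal_processD:
  assumes "determinantal_process M \<Xi> K" "sorted (map fst zs)" "distinct zs"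
  shows "complex_of_real (measure M {\<omega> \<in> space M. \<forall>z\<in>set zs. snd z \<in> \<Xi> (fst z) \<omega>}) =
    Determinant.det (mat (length zs) (length zs)
      (\<lambda>(i, j). K (fst (zs ! i)) (snd (zs ! i)) (fst (zs ! j)) (snd (zs ! j))))"
  using assms unfolding determinantal_process_def case_prod_beta by blast

lemma obtain_sorted_list:
  fixes A :: "('t :: linorder \<times> 'b) set"
  assumes "finite A"
  obtains zs where "set zs = A" "sorted (map fst zs)" "distinct zs"
proof -
  obtain ys where "set ys = A" "distinct ys" using finite_distinct_list[OF assms] by blast
  then show thesis by (intro that[of "sort_key fst ys"]) simp_all
qed

text \<open>Once all shifted times are nonnegative, \<open>nat\<close> no longer merges different
  times, so the shifted list is again sorted and distinct and the determinantal formula applies to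
  it. Earlier \<open>n\<close> are irrelevant to the limit.\<close>

lemma ncrw_correlations_tendsto:
  fixes zs :: "(int \<times> int) list"
  assumes a: "a \<ge> 2" and \<rho>: "\<rho> = 1 / (2 * real a)"
    and process: "determinantal_process M \<Xi> (ncrw_kernel a)"
    and zs: "sorted (map fst zs)" "distinct zs"
  shows "(\<lambda>n. complex_of_real (measure M {\<omega> \<in> space M. \<forall>z\<in>set zs. snd z \<in> \<Xi> (nat (2 * int n + fst z)) \<omega>}))
    \<longlonglongrightarrow> Determinant.det (mat (length zs) (length zs)
      (\<lambda>(i, j). eq_kernel \<rho> (fst (zs ! i)) (snd (zs ! i)) (fst (zs ! j)) (snd (zs ! j))))"
proof (rule Lim_transform_eventually)
  show "(\<lambda>n. Determinant.det (mat (length zs) (length zs)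
      (\<lambda>(i, j). ncrw_kernel a (nat (2 * int n + fst (zs ! i))) (snd (zs ! i))
        (nat (2 * int n + fst (zs ! j))) (snd (zs ! j)))))
    \<longlonglongrightarrow> Determinant.det (mat (length zs) (length zs)
      (\<lambda>(i, j). eq_kernel \<rho> (fst (zs ! i)) (snd (zs ! i)) (fst (zs ! j)) (snd (zs ! j))))"
    by (intro tendsto_det ncrw_kernel_tendsto_eq_kernel a \<rho>)
  have "\<forall>\<^sub>F n in sequentially. \<forall>z\<in>set zs. 2 * int n + fst z \<ge> 0"
  proof (intro eventually_ball_finite ballI)
    fix z assume "z \<in> set zs"
    show "\<forall>\<^sub>F n in sequentially. 2 * int n + fst z \<ge> 0"
      using eventually_ge_at_top[of "nat \<bar>fst z\<bar>"] by eventually_elim auto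
  qed simp
  then show "\<forall>\<^sub>F n in sequentially. Determinant.det (mat (length zs) (length zs)
      (\<lambda>(i, j). ncrw_kernel a (nat (2 * int n + fst (zs ! i))) (snd (zs ! i))
        (nat (2 * int n + fst (zs ! j))) (snd (zs ! j)))) =
      complex_of_real (measure M {\<omega> \<in> space M. \<forall>z\<in>set zs. snd z \<in> \<Xi> (nat (2 * int n + fst z)) \<omega>})"
  proof eventually_elim
    case (elim n)
    define ys where "ys = map (\<lambda>z. (nat (2 * int n + fst z), snd z)) zs"
    have "sorted (map (\<lambda>t. nat (2 * int n + t)) (map fst zs))"
      using zs(1) by (intro sorted_map_mono) (auto intro!: mono_onI)
    then have "sorted (map fst ys)" by (simp add: ys_def o_def)
    moreover have "inj_on (\<lambda>z. (nat (2 * int n + fst z), snd z)) (set zs)"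
    proof (intro inj_onI prod_eqI)
      fix z w assume zw: "z \<in> set zs" "w \<in> set zs"
        and eq: "(nat (2 * int n + fst z), snd z) = (nat (2 * int n + fst w), snd w)"
      have "2 * int n + fst z \<ge> 0" "2 * int n + fst w \<ge> 0" using elim zw by blast+
      from eq_nat_nat_iff[OF this] eq show "fst z = fst w" by simp
      show "snd z = snd w" using eq by simp
    qed
    then have "distinct ys" using zs(2) by (simp add: ys_def distinct_map)
    ultimately have "complex_of_real (measure M {\<omega> \<in> space M. \<forall>z\<in>set ys. snd z \<in> \<Xi> (fst z) \<omega>}) =
      Determinant.det (mat (length ys) (length ys)
        (\<lambda>(i, j). ncrw_kernel a (fst (ys ! i)) (snd (ys ! i)) (fst (ys ! j)) (snd (ys ! j))))"
      by (rule determinantal_processD[OF process])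
    also have "mat (length ys) (length ys)
        (\<lambda>(i, j). ncrw_kernel a (fst (ys ! i)) (snd (ys ! i)) (fst (ys ! j)) (snd (ys ! j))) =
      mat (length zs) (length zs) (\<lambda>(i, j). ncrw_kernel a (nat (2 * int n + fst (zs ! i))) (snd (zs ! i))
        (nat (2 * int n + fst (zs ! j))) (snd (zs ! j)))"
      by (rule eq_matI) (simp_all add: ys_def)
    finally show ?case by (simp add: ys_def)
  qed
qed

section \<open>Finite dimensional distributions and the limit law\<close>

lemma measurable_path:
  assumes "\<And>t. t \<in> J \<Longrightarrow> X t \<in> measurable M config_borel"
  shows "(\<lambda>\<omega>. \<lambda>t\<in>J. X t \<omega>) \<in> measurable M (PiM J (\<lambda>_. config_borel))"
  using assms by (rule measurable_restrict)

lemma measure_fdd: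
  assumes X: "\<And>t. t \<in> J \<Longrightarrow> X t \<in> measurable M config_borel"
    and A: "finite A" "A \<subseteq> J \<times> UNIV"
  shows "measure (fdd M X J) {\<omega> \<in> space (fdd M X J). \<forall>z\<in>A. snd z \<in> \<omega> (fst z)} =
    measure M {\<omega> \<in> space M. \<forall>z\<in>A. snd z \<in> X (fst z) \<omega>}"
proof -
  let ?C = "{\<omega> \<in> PiE J (\<lambda>_. UNIV). \<forall>z\<in>A. snd z \<in> \<omega> (fst z)}"
  have "?C \<in> sets (PiM J (\<lambda>_. config_borel))"
    using sets_cylinder[of A "{}" J] A by simp
  then have "measure (fdd M X J) ?C = measure M ((\<lambda>\<omega>. \<lambda>t\<in>J. X t \<omega>) -` ?C \<inter> space M)"
    unfolding fdd_def using measurable_path[OF X] by (intro measure_distr)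
  also have "(\<lambda>\<omega>. \<lambda>t\<in>J. X t \<omega>) -` ?C \<inter> space M = {\<omega> \<in> space M. \<forall>z\<in>A. snd z \<in> X (fst z) \<omega>}"
  proof (intro Set.set_eqI)
    fix \<omega>
    have "\<forall>z\<in>A. fst z \<in> J" using A(2) by auto
    then have "(\<forall>z\<in>A. snd z \<in> (\<lambda>t\<in>J. X t \<omega>) (fst z)) \<longleftrightarrow> (\<forall>z\<in>A. snd z \<in> X (fst z) \<omega>)"
      by simp
    then show "\<omega> \<in> (\<lambda>\<omega>. \<lambda>t\<in>J. X t \<omega>) -` ?C \<inter> space M \<longleftrightarrow>
        \<omega> \<in> {\<omega> \<in> space M. \<forall>z\<in>A. snd z \<in> X (fst z) \<omega>}" by auto
  qed
  finally show ?thesis by (simp add: fdd_def space_PiM)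
qed

lemma sets_fdd [simp]: "sets (fdd M X J) = sets (PiM J (\<lambda>_. config_borel))"
  by (simp add: fdd_def)

lemma prob_space_fdd:
  assumes "prob_space M" "\<And>t. t \<in> J \<Longrightarrow> X t \<in> measurable M config_borel"
  shows "prob_space (fdd M X J)"
  unfolding fdd_def using prob_space.prob_space_distr[OF assms(1) measurable_path[OF assms(2)]] .

lemma measurable_path_component:
  assumes "sets P = sets (PiM UNIV (\<lambda>_. config_borel))"
  shows "(\<lambda>\<omega>. \<omega> t) \<in> measurable P config_borel"
  using measurable_component_singleton[of t UNIV "\<lambda>_. config_borel"] measurable_cong_sets[OF assms refl] by blast

text \<open>Weak convergence over all finite sets of times reduces to single correlations:
  \<open>measure_fdd\<close> moves a correlation between the whole process and a marginal, and a
  given \<open>A\<close> is tested on the set of times that occur in it.\<close>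

lemma equilibrium_limit_iff:
  fixes P :: "(int \<Rightarrow> int set) measure"
  assumes M: "prob_space M" and X: "\<And>t. \<Xi> t \<in> measurable M config_borel"
  shows "equilibrium_limit M \<Xi> P \<longleftrightarrow> prob_space P \<and> sets P = sets (PiM UNIV (\<lambda>_. config_borel)) \<and>
    (\<forall>A. finite A \<longrightarrow>
      (\<lambda>n. measure M {\<omega> \<in> space M. \<forall>z\<in>A. snd z \<in> \<Xi> (nat (2 * int n + fst z)) \<omega>})
        \<longlonglongrightarrow> measure P {\<omega> \<in> space P. \<forall>z\<in>A. snd z \<in> \<omega> (fst z)})"
    (is "_ \<longleftrightarrow> _ \<and> _ \<and> ?corr")
proof (cases "prob_space P \<and> sets P = sets (PiM UNIV (\<lambda>_. config_borel))")
  case True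
  let ?\<mu> = "\<lambda>J n. fdd M (\<lambda>t. \<Xi> (nat (2 * int n + t))) J"
  let ?\<nu> = "\<lambda>J. fdd P (\<lambda>t \<omega>. \<omega> t) J"
  have \<mu>: "measure (?\<mu> J n) {\<omega> \<in> space (?\<mu> J n). \<forall>z\<in>A. snd z \<in> \<omega> (fst z)} =
      measure M {\<omega> \<in> space M. \<forall>z\<in>A. snd z \<in> \<Xi> (nat (2 * int n + fst z)) \<omega>}"
    if "finite A" "A \<subseteq> J \<times> UNIV" for J A n
    using X that by (rule measure_fdd)
  have \<nu>: "measure (?\<nu> J) {\<omega> \<in> space (?\<nu> J). \<forall>z\<in>A. snd z \<in> \<omega> (fst z)} =
      measure P {\<omega> \<in> space P. \<forall>z\<in>A. snd z \<in> \<omega> (fst z)}"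
    if "finite A" "A \<subseteq> J \<times> UNIV" for J A
    using measurable_path_component that True by (intro measure_fdd) auto
  have "weakly_converges (product_topology (\<lambda>_. vague_topology) J) (?\<mu> J) (?\<nu> J)" if "finite J" ?corr for J
  proof (rule weakly_converges_correlations[OF that(1)])
    show "prob_space (?\<mu> J n)" for n by (rule prob_space_fdd[OF M X])
    show "prob_space (?\<nu> J)" using True measurable_path_component by (intro prob_space_fdd) auto
  qed (use \<mu> \<nu> that in auto)
  moreover have ?corr
    if conv: "\<forall>J. finite J \<longrightarrow> weakly_converges (product_topology (\<lambda>_. vague_topology) J) (?\<mu> J) (?\<nu> J)"
  proof (intro allI impI)
    fix A :: "(int \<times> int) set" assume A: "finite A"
    have sub: "A \<subseteq> fst ` A \<times> UNIV" by (auto intro: rev_image_eqI)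
    from weakly_converges_imp_correlations[OF _ _ _ conv[rule_format] A sub]
    show "(\<lambda>n. measure M {\<omega> \<in> space M. \<forall>z\<in>A. snd z \<in> \<Xi> (nat (2 * int n + fst z)) \<omega>})
        \<longlonglongrightarrow> measure P {\<omega> \<in> space P. \<forall>z\<in>A. snd z \<in> \<omega> (fst z)}"
      using A by (simp add: \<mu>[OF A sub] \<nu>[OF A sub])
  qed
  ultimately show ?thesis using True unfolding equilibrium_limit_def by blast
qed (auto simp: equilibrium_limit_def)

lemma equilibrium_limit_determinantal:
  assumes a: "a \<ge> 2" and \<rho>: "\<rho> = 1 / (2 * real a)"
    and process: "determinantal_process M \<Xi> (ncrw_kernel a)"
    and P: "equilibrium_limit M \<Xi> P"
  shows "determinantal_process P (\<lambda>t \<omega>. \<omega> t) (eq_kernel \<rho>)"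
  unfolding determinantal_process_def
proof (intro conjI allI impI)
  have M: "prob_space M" "\<And>t. \<Xi> t \<in> measurable M config_borel"
    using process by (simp_all add: determinantal_process_def)
  note lim = P[unfolded equilibrium_limit_iff[OF M]]
  show "prob_space P" by (rule conjunct1[OF lim])
  show "(\<lambda>\<omega>. \<omega> t) \<in> measurable P config_borel" for t
    by (rule measurable_path_component[OF conjunct1[OF conjunct2[OF lim]]])
  fix zs :: "(int \<times> int) list" assume zs: "sorted (map fst zs) \<and> distinct zs"
  have "(\<lambda>n. complex_of_real (measure M {\<omega> \<in> space M. \<forall>z\<in>set zs. snd z \<in> \<Xi> (nat (2 * int n + fst z)) \<omega>}))
    \<longlonglongrightarrow> complex_of_real (measure P {\<omega> \<in> space P. \<forall>z\<in>set zs. snd z \<in> \<omega> (fst z)})"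
    by (intro tendsto_of_real conjunct2[OF conjunct2[OF lim], rule_format] finite_set)
  from LIMSEQ_unique[OF this ncrw_correlations_tendsto[OF a \<rho> process]] zs
  show "complex_of_real (measure P {\<omega> \<in> space P. \<forall>(t, x)\<in>set zs. x \<in> \<omega> t}) =
     Determinant.det (mat (length zs) (length zs)
       (\<lambda>(i, j). eq_kernel \<rho> (fst (zs ! i)) (snd (zs ! i)) (fst (zs ! j)) (snd (zs ! j))))"
    by (simp add: case_prod_beta)
qed

text \<open>The events that x is occupied at time 2n + t, indexed by (t, x), are fed to
  \<open>kolmogorov_extension_events\<close>. The resulting real variables are read back as a path
  of configurations by placing a point wherever the value is 1.\<close>

lemma equilibrium_limit_exists:
  assumes a: "a \<ge> 2" and process: "determinantal_process M \<Xi> (ncrw_kernel a)"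
  shows "\<exists>P. equilibrium_limit M \<Xi> P"
proof -
  have X: "\<And>t. \<Xi> t \<in> measurable M config_borel"
    using process by (simp_all add: determinantal_process_def)
  interpret prob_space M using process by (simp add: determinantal_process_def)
  define E where "E n z = {\<omega> \<in> space M. snd z \<in> \<Xi> (nat (2 * int n + fst z)) \<omega>}" for n :: nat and z :: "int \<times> int"
  define q where "q A = lim (\<lambda>n. measure M {\<omega> \<in> space M. \<forall>z\<in>A. \<omega> \<in> E n z})" for A
  have q: "(\<lambda>n. measure M {\<omega> \<in> space M. \<forall>z\<in>A. \<omega> \<in> E n z}) \<longlonglongrightarrow> q A" if "finite A" for A
  proof -
    obtain zs where zs: "set zs = A" "sorted (map fst zs)" "distinct zs"
      using obtain_sorted_list[OF \<open>finite A\<close>] .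
    have eq: "{\<omega> \<in> space M. \<forall>z\<in>A. \<omega> \<in> E n z} =
        {\<omega> \<in> space M. \<forall>z\<in>set zs. snd z \<in> \<Xi> (nat (2 * int n + fst z)) \<omega>}" for n
      by (auto simp: E_def zs(1))
    \<comment> \<open>The determinants are complex; real parts give convergence of the probabilities
      themselves.\<close>
    from tendsto_Re[OF ncrw_correlations_tendsto[OF a refl process zs(2,3)]]
    have "convergent (\<lambda>n. measure M {\<omega> \<in> space M. \<forall>z\<in>A. \<omega> \<in> E n z})"
      unfolding eq by (auto intro: convergentI)
    then show ?thesis by (simp add: q_def convergent_LIMSEQ_iff)
  qed
  have E: "E n z \<in> sets M" for n z
    using measurable_mem_config[OF X] by (simp add: E_def pred_def)
  obtain R :: "(int \<times> int \<Rightarrow> real) measure" where R: "prob_space R" "sets R = sets (PiM UNIV (\<lambda>_. borel))"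
    "\<forall>A. finite A \<longrightarrow> measure R {\<omega> \<in> space R. \<forall>z\<in>A. \<omega> z = 1} = q A"
    using kolmogorov_extension_events[of E q, OF E q] by blast
  define \<Phi> where "\<Phi> \<omega> = (\<lambda>t. {x. \<omega> (t, x) = 1})" for \<omega> :: "int \<times> int \<Rightarrow> real"
  have "(\<lambda>\<omega>. {x. \<omega> (t, x) = 1}) \<in> measurable R config_borel" for t
  proof (rule measurable_config_borelI)
    fix x
    have "(\<lambda>\<omega>. \<omega> (t, x)) \<in> borel_measurable R"
      using measurable_component_singleton[of "(t, x)" UNIV "\<lambda>_. borel :: real measure"]
        measurable_cong_sets[OF R(2) refl] by blast
    then have "{\<omega> \<in> space R. \<omega> (t, x) = 1} \<in> sets R" by measurable
    then show "Measurable.pred R (\<lambda>\<omega>. x \<in> {x. \<omega> (t, x) = 1})" by (simp add: pred_def)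
  qed
  from measurable_path[of UNIV "\<lambda>t \<omega>. {x. \<omega> (t, x) = 1}", OF this]
  have \<Phi>: "\<Phi> \<in> measurable R (PiM UNIV (\<lambda>_. config_borel))"
    by (simp add: \<Phi>_def[abs_def] restrict_UNIV)
  define P where "P = distr R (PiM UNIV (\<lambda>_. config_borel)) \<Phi>"
  have corr: "measure P {\<omega> \<in> space P. \<forall>z\<in>A. snd z \<in> \<omega> (fst z)} = q A" if A: "finite A" for A
  proof -
    let ?C = "{\<omega> \<in> PiE UNIV (\<lambda>_. UNIV). \<forall>z\<in>A. snd z \<in> \<omega> (fst z)}"
    have "?C \<in> sets (PiM UNIV (\<lambda>_. config_borel))"
      using sets_cylinder[of A "{}" UNIV] A by simp
    then have "measure P ?C = measure R (\<Phi> -` ?C \<inter> space R)"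
      unfolding P_def using \<Phi> by (intro measure_distr)
    also have "\<Phi> -` ?C \<inter> space R = {\<omega> \<in> space R. \<forall>z\<in>A. \<omega> z = 1}" by (auto simp: \<Phi>_def)
    finally show ?thesis using R(3) A by (simp add: P_def space_PiM)
  qed
  have "equilibrium_limit M \<Xi> P"
    unfolding equilibrium_limit_iff[OF prob_space_axioms X]
  proof (intro conjI allI impI)
    show "prob_space P" unfolding P_def by (rule prob_space.prob_space_distr[OF R(1) \<Phi>])
    show "sets P = sets (PiM UNIV (\<lambda>_. config_borel))" by (simp add: P_def)
    fix A :: "(int \<times> int) set" assume A: "finite A"
    have "{\<omega> \<in> space M. \<forall>z\<in>A. \<omega> \<in> E n z} =
        {\<omega> \<in> space M. \<forall>z\<in>A. snd z \<in> \<Xi> (nat (2 * int n + fst z)) \<omega>}" for n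
      by (auto simp: E_def)
    with q[OF A] corr[OF A]
    show "(\<lambda>n. measure M {\<omega> \<in> space M. \<forall>z\<in>A. snd z \<in> \<Xi> (nat (2 * int n + fst z)) \<omega>})
        \<longlonglongrightarrow> measure P {\<omega> \<in> space P. \<forall>z\<in>A. snd z \<in> \<omega> (fst z)}" by simp
  qed
  then show ?thesis by blast
qed

section \<open>Time reversal and one-time marginals\<close>

lemma eq_kernel_reverse: "eq_kernel \<rho> (- s) x (- t) y = eq_kernel \<rho> t y s x"
proof -
  have "eq_fun \<rho> \<tau> (- z) = eq_fun \<rho> \<tau> z" for \<tau> z
    by (simp add: eq_fun_def sine_fun_def)
  from this[of "s - t" "x - y"] show ?thesis by (auto simp: eq_kernel_def)
qed

text \<open>The kernel is even in the spatial difference, so negating both times exchanges its two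
  arguments. Negation also reverses the order of the times, hence \<open>ys\<close> is built with
  \<open>rev\<close> to be sorted; its matrix is the reversed transpose of the matrix of
  \<open>zs\<close>.\<close>

lemma determinantal_eq_kernel_time_reversible:
  assumes P: "determinantal_process P (\<lambda>t \<omega>. \<omega> t) (eq_kernel \<rho>)"
  shows "time_reversible P"
  unfolding time_reversible_def
proof (intro allI impI)
  fix J :: "int set" assume "finite J"
  have prob: "prob_space P" and meas: "\<And>t. (\<lambda>\<omega>. \<omega> t) \<in> measurable P config_borel"
    using P by (simp_all add: determinantal_process_def)
  show "fdd P (\<lambda>t \<omega>. \<omega> (- t)) J = fdd P (\<lambda>t \<omega>. \<omega> t) J"
  proof (rule measure_eq_correlations[where J = J])
    fix A :: "(int \<times> int) set" assume A: "finite A" "A \<subseteq> J \<times> UNIV"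
    obtain zs where zs: "set zs = A" "sorted (map fst zs)" "distinct zs"
      using obtain_sorted_list[OF A(1)] .
    define k where "k = length zs"
    define ys where "ys = rev (map (\<lambda>z. (- fst z, snd z)) zs)"
    have "sorted_wrt (\<ge>) (map (\<lambda>z. - fst z) zs)"
      using zs(2) by (simp add: sorted_wrt_map)
    then have "sorted (map fst ys)"
      by (simp add: ys_def rev_map[symmetric] o_def sorted_wrt_rev)
    moreover have "distinct ys"
      using zs(3) by (auto simp: ys_def distinct_map inj_on_def prod_eq_iff)
    ultimately have "complex_of_real (measure P {\<omega> \<in> space P. \<forall>z\<in>set ys. snd z \<in> \<omega> (fst z)}) =
      Determinant.det (mat (length ys) (length ys)
        (\<lambda>(i, j). eq_kernel \<rho> (fst (ys ! i)) (snd (ys ! i)) (fst (ys ! j)) (snd (ys ! j))))"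
      by (rule determinantal_processD[OF P])
    also have "mat (length ys) (length ys)
        (\<lambda>(i, j). eq_kernel \<rho> (fst (ys ! i)) (snd (ys ! i)) (fst (ys ! j)) (snd (ys ! j))) =
      mat k k (\<lambda>(i, j). eq_kernel \<rho> (fst (zs ! (k - 1 - j))) (snd (zs ! (k - 1 - j)))
        (fst (zs ! (k - 1 - i))) (snd (zs ! (k - 1 - i))))"
      by (rule eq_matI) (simp_all add: ys_def k_def rev_nth eq_kernel_reverse)
    also have "Determinant.det \<dots> = Determinant.det (mat k k
        (\<lambda>(i, j). eq_kernel \<rho> (fst (zs ! i)) (snd (zs ! i)) (fst (zs ! j)) (snd (zs ! j))))"
      by (rule det_reverse_transpose)
    also have "\<dots> = complex_of_real (measure P {\<omega> \<in> space P. \<forall>z\<in>set zs. snd z \<in> \<omega> (fst z)})"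
      unfolding k_def by (rule determinantal_processD[OF P zs(2,3), symmetric])
    finally have "measure P {\<omega> \<in> space P. \<forall>z\<in>set ys. snd z \<in> \<omega> (fst z)} =
        measure P {\<omega> \<in> space P. \<forall>z\<in>A. snd z \<in> \<omega> (fst z)}"
      by (simp only: of_real_eq_iff zs(1))
    moreover have "(\<forall>z\<in>set ys. snd z \<in> \<omega> (fst z)) \<longleftrightarrow> (\<forall>z\<in>A. snd z \<in> \<omega> (- fst z))" for \<omega> :: "int \<Rightarrow> int set"
      by (simp add: ys_def zs(1))
    ultimately show "measure (fdd P (\<lambda>t \<omega>. \<omega> (- t)) J) {\<omega> \<in> space (fdd P (\<lambda>t \<omega>. \<omega> (- t)) J). \<forall>z\<in>A. snd z \<in> \<omega> (fst z)} =
        measure (fdd P (\<lambda>t \<omega>. \<omega> t) J) {\<omega> \<in> space (fdd P (\<lambda>t \<omega>. \<omega> t) J). \<forall>z\<in>A. snd z \<in> \<omega> (fst z)}"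
      using meas by (simp only: measure_fdd[OF meas A])
  qed (simp_all add: prob_space_fdd[OF prob meas])
qed

text \<open>At equal times only the branch of \<open>eq_fun\<close> with time difference 0 enters,
  and the parity condition at time \<tau> cuts out one sublattice.\<close>

lemma determinantal_law_marginal:
  assumes P: "determinantal_process P (\<lambda>t \<omega>. \<omega> t) (eq_kernel \<rho>)"
  shows "determinantal_law (distr P config_borel (\<lambda>\<omega>. \<omega> \<tau>)) (sine_kernel \<rho> {x. even (\<tau> + x)})"
  unfolding determinantal_law_def
proof (intro conjI allI impI)
  have meas: "(\<lambda>\<omega>. \<omega> \<tau>) \<in> measurable P config_borel"
    using P by (simp add: determinantal_process_def)
  show "prob_space (distr P config_borel (\<lambda>\<omega>. \<omega> \<tau>))"
    using P meas by (simp add: determinantal_process_def prob_space.prob_space_distr)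
  show "sets (distr P config_borel (\<lambda>\<omega>. \<omega> \<tau>)) = sets config_borel" by simp
  fix xs :: "int list" assume xs: "distinct xs"
  define zs where "zs = map (Pair \<tau>) xs"
  have "{\<xi>. set xs \<subseteq> \<xi>} \<in> sets config_borel"
    unfolding sets_config_borel by (intro sigma_sets.Basic) blast
  then have "measure (distr P config_borel (\<lambda>\<omega>. \<omega> \<tau>)) {\<xi>. set xs \<subseteq> \<xi>} =
      measure P ((\<lambda>\<omega>. \<omega> \<tau>) -` {\<xi>. set xs \<subseteq> \<xi>} \<inter> space P)"
    by (intro measure_distr meas)
  also have "(\<lambda>\<omega>. \<omega> \<tau>) -` {\<xi>. set xs \<subseteq> \<xi>} \<inter> space P = {\<omega> \<in> space P. \<forall>z\<in>set zs. snd z \<in> \<omega> (fst z)}"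
    by (auto simp: zs_def)
  also have "complex_of_real (measure P \<dots>) = Determinant.det (mat (length zs) (length zs)
      (\<lambda>(i, j). eq_kernel \<rho> (fst (zs ! i)) (snd (zs ! i)) (fst (zs ! j)) (snd (zs ! j))))"
    using xs by (intro determinantal_processD[OF P])
      (simp_all add: zs_def o_def distinct_map inj_on_def map_replicate_const)
  also have "mat (length zs) (length zs)
      (\<lambda>(i, j). eq_kernel \<rho> (fst (zs ! i)) (snd (zs ! i)) (fst (zs ! j)) (snd (zs ! j))) =
      mat (length xs) (length xs) (\<lambda>(i, j). sine_kernel \<rho> {x. even (\<tau> + x)} (xs ! i) (xs ! j))"
    by (rule eq_matI) (auto simp: zs_def eq_kernel_def sine_kernel_def eq_fun_def)
  finally show "complex_of_real (measure (distr P config_borel (\<lambda>\<omega>. \<omega> \<tau>))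
        {\<xi> \<in> space (distr P config_borel (\<lambda>\<omega>. \<omega> \<tau>)). set xs \<subseteq> \<xi>}) =
      Determinant.det (mat (length xs) (length xs) (\<lambda>(i, j). sine_kernel \<rho> {x. even (\<tau> + x)} (xs ! i) (xs ! j)))"
    by simp
qed

lemma mu_sin_eq:
  assumes "determinantal_law \<mu> (sine_kernel \<rho> S)"
  shows "mu_sin \<rho> S = \<mu>"
  unfolding mu_sin_def using assms determinantal_law_unique[OF _ assms] by (rule the_equality)

text \<open>\<open>equilibrium_limit\<close> speaks of laws on functions defined on the singleton
  \<open>{\<tau>}\<close>. Composition with evaluation at \<tau> makes a test function of one
  configuration into a test function there.\<close>

lemma weakly_converges_marginal:
  assumes M: "\<And>t. \<Xi> t \<in> measurable M config_borel" and P: "equilibrium_limit M \<Xi> P"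
  shows "weakly_converges vague_topology (\<lambda>n. distr M config_borel (\<Xi> (nat (2 * int n + \<tau>))))
    (distr P config_borel (\<lambda>\<omega>. \<omega> \<tau>))"
  unfolding weakly_converges_def
proof (intro allI impI, elim conjE)
  fix f assume f: "continuous_map vague_topology euclideanreal f" and bdd: "bounded (f ` topspace vague_topology)"
  let ?X = "product_topology (\<lambda>_. vague_topology) {\<tau>}"
  let ?g = "\<lambda>\<omega> :: int \<Rightarrow> int set. f (\<omega> \<tau>)"
  have g: "continuous_map ?X euclideanreal ?g"
    using continuous_map_compose[OF continuous_map_product_projection[of \<tau> "{\<tau>}" "\<lambda>_. vague_topology"] f]
    by (simp add: o_def)
  have "bounded (?g ` topspace ?X)"
    using bdd by (rule bounded_subset) auto
  moreover have "weakly_converges ?X (\<lambda>n. fdd M (\<lambda>t. \<Xi> (nat (2 * int n + t))) {\<tau>}) (fdd P (\<lambda>t \<omega>. \<omega> t) {\<tau>})"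
    using P unfolding equilibrium_limit_def by simp
  ultimately have lim: "(\<lambda>n. \<integral>\<omega>. ?g \<omega> \<partial>fdd M (\<lambda>t. \<Xi> (nat (2 * int n + t))) {\<tau>}) \<longlonglongrightarrow>
      (\<integral>\<omega>. ?g \<omega> \<partial>fdd P (\<lambda>t \<omega>. \<omega> t) {\<tau>})"
    using g unfolding weakly_converges_def by blast
  have gm: "?g \<in> borel_measurable (PiM {\<tau>} (\<lambda>_. config_borel))"
    using borel_measurable_continuous_vague[OF _ g] by simp
  \<comment> \<open>\<open>f\<close> is recovered from \<open>?g\<close> by embedding a
    configuration as a path with the single time \<tau>, which transfers measurability.\<close>
  have "(\<lambda>\<xi>. \<lambda>t\<in>{\<tau>}. \<xi>) \<in> measurable config_borel (PiM {\<tau>} (\<lambda>_. config_borel))"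
    by (rule measurable_path) simp
  from measurable_compose[OF this gm] have fm: "f \<in> borel_measurable config_borel" by simp
  have eq: "(\<integral>\<omega>. ?g \<omega> \<partial>fdd N X {\<tau>}) = (\<integral>\<xi>. f \<xi> \<partial>distr N config_borel (X \<tau>))"
    if "X \<tau> \<in> measurable N config_borel" for N and X :: "int \<Rightarrow> 'c \<Rightarrow> int set"
  proof -
    have "(\<lambda>\<omega>. \<lambda>t\<in>{\<tau>}. X t \<omega>) \<in> measurable N (PiM {\<tau>} (\<lambda>_. config_borel))"
      using that by (intro measurable_path) simp
    then have "(\<integral>\<omega>. ?g \<omega> \<partial>fdd N X {\<tau>}) = (\<integral>\<omega>. f (X \<tau> \<omega>) \<partial>N)"
      unfolding fdd_def by (subst integral_distr[OF _ gm]) simp_all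
    also have "\<dots> = (\<integral>\<xi>. f \<xi> \<partial>distr N config_borel (X \<tau>))"
      by (rule integral_distr[OF that fm, symmetric])
    finally show ?thesis .
  qed
  show "(\<lambda>n. \<integral>\<xi>. f \<xi> \<partial>distr M config_borel (\<Xi> (nat (2 * int n + \<tau>)))) \<longlonglongrightarrow>
      (\<integral>\<xi>. f \<xi> \<partial>distr P config_borel (\<lambda>\<omega>. \<omega> \<tau>))"
    using lim eq[of "\<lambda>t. \<Xi> (nat (2 * int n + t))" M for n, OF M] eq[of "\<lambda>t \<omega>. \<omega> t" P, OF measurable_path_component] P
    by (simp add: equilibrium_limit_def)
qed

theorem theorem4p4:
  fixes a :: nat and \<rho> :: real
    and M :: "'w measure" and \<Xi> :: "nat \<Rightarrow> 'w \<Rightarrow> int set"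
  assumes "a \<ge> 2" and "\<rho> = 1 / (2 * real a)"
    and "ncrw_process a M \<Xi>"
  shows "determinantal_law (mu_sin \<rho> {x. even x}) (sine_kernel \<rho> {x. even x}) \<and>
         determinantal_law (mu_sin \<rho> {x. odd x}) (sine_kernel \<rho> {x. odd x}) \<and>
         weakly_converges vague_topology
           (\<lambda>n. distr M config_borel (\<Xi> (2 * n))) (mu_sin \<rho> {x. even x}) \<and>
         weakly_converges vague_topology
           (\<lambda>n. distr M config_borel (\<Xi> (2 * n + 1))) (mu_sin \<rho> {x. odd x}) \<and>
         (\<exists>P. equilibrium_limit M \<Xi> P) \<and>
         (\<forall>P. equilibrium_limit M \<Xi> P \<longrightarrow>
            time_reversible P \<and> determinantal_process P (\<lambda>t \<omega>. \<omega> t) (eq_kernel \<rho>))"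
proof -
  have process: "determinantal_process M \<Xi> (ncrw_kernel a)"
    using assms(3) by (simp add: ncrw_process_def)
  then have meas: "\<Xi> t \<in> measurable M config_borel" for t
    by (simp add: determinantal_process_def)
  note det = equilibrium_limit_determinantal[OF assms(1,2) process]
  obtain P where P: "equilibrium_limit M \<Xi> P"
    using equilibrium_limit_exists[OF assms(1) process] by blast
  \<comment> \<open>Times 0 and 1 carry the even and the odd sublattice. Existence of both sine
    processes comes from these marginals of \<open>P\<close>, and \<open>mu_sin_eq\<close>
    identifies them with the definite descriptions.\<close>
  have law: "determinantal_law (distr P config_borel (\<lambda>\<omega>. \<omega> 0)) (sine_kernel \<rho> {x. even x})"
    "determinantal_law (distr P config_borel (\<lambda>\<omega>. \<omega> 1)) (sine_kernel \<rho> {x. odd x})"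
    using determinantal_law_marginal[OF det[OF P], of 0] determinantal_law_marginal[OF det[OF P], of 1]
    by simp_all
  have nat: "nat (2 * int n + 0) = 2 * n" "nat (2 * int n + 1) = 2 * n + 1" for n by simp_all
  note conv = weakly_converges_marginal[OF meas P, of 0] weakly_converges_marginal[OF meas P, of 1]
  show ?thesis
    using law conv[unfolded nat] P det determinantal_eq_kernel_time_reversible
    unfolding law[THEN mu_sin_eq] by blast
qed

end
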